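(* Consider $\min_{X\in\mathcal{M}} f(X)+g(AX)$ with $A\in\mathbb{R}^{d\times n}$, where: $\mathcal{M}$ is a compact Riemannian submanifold embedded in the Euclidean space $\mathbb{R}^{n\times r}$; $f:\mathcal{M}\to\mathbb{R}$ is smooth (not necessarily convex); $g:\mathbb{R}^{d\times r}\to\mathbb{R}$ is convex (possibly nonsmooth) and its subdifferentials $\partial g(Y)$ are bounded uniformly over all $Y\in\mathbb{R}^{d\times r}$. Let $\{W^k\}_{k\in\mathbb{N}}$, $W^k=[X^k;Y^k]$, be a sequence generated by the manifold inexact augmented Lagrangian method (MIALM, described in the context) such that for every $k$ the iterate $X^{k+1}\in\mathcal{M}$ satisfies $$\|\mathrm{grad}\,\psi_k(X^{k+1})\|\le \epsilon_k .$$ Then $\{W^k\}_{k\in\mathbb{N}}$ has at least one cluster point. Furthermore, if $W^*$ is a cluster point of $\{W^k\}_{k\in\mathbb{N}}$ and LICQ holds at $W^*$, then $W^*$ is a KKT point of the problem $\min_W \theta(W)$ subject to $h(W)=0$, $W\in\mathcal{N}$.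
   Context: Notation. $\mathcal{N}=\mathcal{M}\times\mathbb{R}^{d\times r}$ is the product manifold, a Riemannian submanifold of $\mathbb{R}^{(n+d)\times r}$; $W=[X;Y]\in\mathcal{N}$; $\theta(W)=f(X)+g(Y)$; $h(W)=[A,-I]W=AX-Y\in\mathbb{R}^{d\times r}$, with entries $[h(W)]_{ij}$. $\mathrm{grad}$ denotes the Riemannian gradient with respect to the metric induced from the ambient Euclidean space (on $\mathcal{M}$ for functions of $X$, on $\mathcal{N}$ for functions of $W$). $\langle\cdot,\cdot\rangle$ and $\|\cdot\|_F$ are the Frobenius inner product and norm, and $\|M\|_\infty=\max_{i,j}|M_{ij}|$. $\mathrm{Prox}_{\mu g}(V)=\arg\min_Y\{g(Y)+\frac{1}{2\mu}\|Y-V\|_F^2\}$. Augmented Lagrangian: $\mathcal{L}_\rho(X,Y;Z)=f(X)+g(Y)-\langle Z,AX-Y\rangle+\frac{\rho}{2}\|AX-Y\|_F^2$. MIALM. Input: matrices $Z_{\min}<Z_{\max}$ in $\mathbb{R}^{d\times r}$ (entrywise), $X^0\in\mathcal{M}$, $Y^0\in\mathbb{R}^{d\times r}$, $\bar Z^0\in\mathbb{R}^{d\times r}$, $\rho_0>1$, $\sigma>1$, $0<\tau<1$, and positive tolerances $\{\epsilon_k\}_{k\in\mathbb{N}}$ decreasing to $0$. For $k=0,1,2,\dots$: (1) Let $\psi_k(X)=\inf_{Y\in\mathbb{R}^{d\times r}}\mathcal{L}_{\rho_k}(X,Y;\bar Z^k)$ for $X\in\mathcal{M}$. Compute $X^{k+1}\in\mathcal{M}$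 by solving $\min_{X\in\mathcal{M}}\psi_k(X)$ inexactly with tolerance $\epsilon_k$, and set $Y^{k+1}=\mathrm{Prox}_{g/\rho_k}(AX^{k+1}-\frac{1}{\rho_k}\bar Z^k)$. (2) $Z^{k+1}=\bar Z^k-\rho_k(AX^{k+1}-Y^{k+1})$. (3) $\bar Z^{k+1}$ is the projection of $Z^{k+1}$ onto $\{Z: Z_{\min}\le Z\le Z_{\max}\}$ (entrywise inequalities). (4) $\rho_{k+1}=\rho_k$ if $\|AX^{k+1}-Y^{k+1}\|_\infty\le\tau\|AX^k-Y^k\|_\infty$, and $\rho_{k+1}=\sigma\rho_k$ otherwise. LICQ at $W^*\in\mathcal{N}$: the vectors $\{\mathrm{grad}[h(W^* )]_{ij}: i=1,\dots,d,\ j=1,\dots,r\}$ are linearly independent in $T_{W^*}\mathcal{N}$. KKT point: $W^*\in\mathcal{N}$ is a KKT point if $h(W^* )=0$ and there is $Z^*\in\mathbb{R}^{d\times r}$ with $0\in\partial\theta(W^* )+\sum_{i=1}^d\sum_{j=1}^r Z^*_{ij}\,\mathrm{grad}[h(W^* )]_{ij}$, where $\partial\theta$ is the Riemannian (Clarke) subdifferential of $\theta$ on $\mathcal{N}$, which here is $\partial\theta(W)=\{\mathrm{grad}f(X)\}\times\partial g(Y)$, $\partial g$ being the usual convex subdifferential. *)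

theory Defs
  imports "HOL-Analysis.Analysis"
begin

section \<open>Smooth maps and embedded submanifolds of Euclidean spaces\<close>

text \<open>Used for open sets \<open>S\<close> only, where it is the usual notion of a \<open>C\<^sup>k\<close> map.\<close>

primrec Ck_on ::
  "nat \<Rightarrow> 'a::euclidean_space set \<Rightarrow> ('a \<Rightarrow> 'b::euclidean_space) \<Rightarrow> bool" where
  "Ck_on 0 S f \<longleftrightarrow> continuous_on S f"
| "Ck_on (Suc k) S f \<longleftrightarrow>
     (\<forall>x\<in>S. f differentiable (at x)) \<and>
     (\<forall>v. Ck_on k S (\<lambda>x. frechet_derivative f (at x) v))"

definition smooth_on ::
  "'a::euclidean_space set \<Rightarrow> ('a \<Rightarrow> 'b::euclidean_space) \<Rightarrow> bool" where
  "smooth_on S f \<longleftrightarrow> (\<forall>k. Ck_on k S f)"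

text \<open>A chart \<open>(U, \<Phi>, \<Psi>, S)\<close> of \<open>M\<close> around \<open>x\<close>: a diffeomorphism \<open>\<Phi>\<close> with inverse \<open>\<Psi>\<close> from
  the open set \<open>U\<close> of the ambient space onto the open set \<open>\<Phi> ` U\<close>, which flattens \<open>M \<inter> U\<close>
  to a piece of the linear subspace \<open>S\<close>.\<close>

definition slice_chart ::
  "'a::euclidean_space set \<Rightarrow> 'a \<Rightarrow> 'a set \<Rightarrow> ('a \<Rightarrow> 'a) \<Rightarrow> ('a \<Rightarrow> 'a) \<Rightarrow> 'a set \<Rightarrow> bool" where
  "slice_chart M x U \<Phi> \<Psi> S \<longleftrightarrow>
     open U \<and> x \<in> U \<and> open (\<Phi> ` U) \<and>
     smooth_on U \<Phi> \<and> smooth_on (\<Phi> ` U) \<Psi> \<and> (\<forall>y\<in>U. \<Psi> (\<Phi> y) = y) \<and>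
     subspace S \<and> \<Phi> ` (M \<inter> U) = \<Phi> ` U \<inter> S"

definition embedded_submanifold :: "'a::euclidean_space set \<Rightarrow> bool" where
  "embedded_submanifold M \<longleftrightarrow>
     (\<exists>m. \<forall>x\<in>M. \<exists>U \<Phi> \<Psi> S. slice_chart M x U \<Phi> \<Psi> S \<and> dim S = m)"

text \<open>A function on \<open>M\<close> is represented by a total function, whose values outside \<open>M\<close> are
  irrelevant; it is smooth if it locally extends to a smooth function on the ambient space.\<close>

definition smooth_on_manifold ::
  "'a::euclidean_space set \<Rightarrow> ('a \<Rightarrow> 'b::euclidean_space) \<Rightarrow> bool" where
  "smooth_on_manifold M f \<longleftrightarrow>
     (\<forall>x\<in>M. \<exists>U F. open U \<and> x \<in> U \<and> smooth_on U F \<and> (\<forall>y\<in>M \<inter> U. F y = f y))"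

definition curve_through ::
  "'a::euclidean_space set \<Rightarrow> 'a \<Rightarrow> 'a \<Rightarrow> (real \<Rightarrow> 'a) \<Rightarrow> bool" where
  "curve_through M x v c \<longleftrightarrow>
     (\<exists>e>0. smooth_on {-e<..<e} c \<and> c ` {-e<..<e} \<subseteq> M) \<and>
     c 0 = x \<and> (c has_vector_derivative v) (at 0)"

definition tangent_space :: "'a::euclidean_space set \<Rightarrow> 'a \<Rightarrow> 'a set" where
  "tangent_space M x = {v. \<exists>c. curve_through M x v c}"

section \<open>Riemannian gradient and Riemannian Clarke subdifferential\<close>

text \<open>The metric is the one induced by the inner product of the ambient space. The gradient is
  the tangent vector \<open>\<xi>\<close> with \<open>\<xi> \<bullet> v = DF(x)[v]\<close> for all tangent vectors \<open>v\<close>, where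
  \<open>DF(x)[v] = (F \<circ> c)'(0)\<close> for any curve \<open>c\<close> in \<open>M\<close> through \<open>x\<close> with velocity \<open>v\<close>.\<close>

definition has_rgrad ::
  "'a::euclidean_space set \<Rightarrow> ('a \<Rightarrow> real) \<Rightarrow> 'a \<Rightarrow> 'a \<Rightarrow> bool" where
  "has_rgrad M F x \<xi> \<longleftrightarrow>
     \<xi> \<in> tangent_space M x \<and>
     (\<forall>v c. curve_through M x v c \<longrightarrow> ((\<lambda>t. F (c t)) has_real_derivative \<xi> \<bullet> v) (at 0))"

definition rgrad :: "'a::euclidean_space set \<Rightarrow> ('a \<Rightarrow> real) \<Rightarrow> 'a \<Rightarrow> 'a" where
  "rgrad M F x = (THE \<xi>. has_rgrad M F x \<xi>)"

text \<open>Generalized directional derivative of \<open>F\<close> at \<open>x\<close> along \<open>v\<close>, read in the chart \<open>\<Phi>\<close>: the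
  upper limit, as \<open>y \<rightarrow> x\<close> in \<open>M\<close> (\<open>y = x\<close> allowed) and \<open>t \<down> 0\<close>, of
  \<open>(F (\<Phi>\<^sup>-\<^sup>1 (\<Phi> y + t D\<Phi>(x)[v])) - F y) / t\<close>.\<close>

definition rclarke_dir ::
  "'a::euclidean_space set \<Rightarrow> ('a \<Rightarrow> real) \<Rightarrow> 'a \<Rightarrow> ('a \<Rightarrow> 'a) \<Rightarrow> ('a \<Rightarrow> 'a) \<Rightarrow> 'a \<Rightarrow> ereal" where
  "rclarke_dir M F x \<Phi> \<Psi> v =
     Limsup (inf (nhds x) (principal M) \<times>\<^sub>F at_right 0)
       (\<lambda>(y, t). ereal ((F (\<Psi> (\<Phi> y + t *\<^sub>R frechet_derivative \<Phi> (at x) v)) - F y) / t))"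

text \<open>For locally Lipschitz \<open>F\<close> the generalized directional derivative does not depend on the
  chart, so quantifying over all charts amounts to using any one of them.\<close>

definition rclarke_subdiff ::
  "'a::euclidean_space set \<Rightarrow> ('a \<Rightarrow> real) \<Rightarrow> 'a \<Rightarrow> 'a set" where
  "rclarke_subdiff M F x =
     {\<xi> \<in> tangent_space M x. \<forall>U \<Phi> \<Psi> S. slice_chart M x U \<Phi> \<Psi> S \<longrightarrow>
        (\<forall>v \<in> tangent_space M x. ereal (\<xi> \<bullet> v) \<le> rclarke_dir M F x \<Phi> \<Psi> v)}"

section \<open>Convex analysis and sequences\<close>

definition subdiff :: "('a::real_inner \<Rightarrow> real) \<Rightarrow> 'a \<Rightarrow> 'a set" where
  "subdiff g y = {v. \<forall>z. g z \<ge> g y + v \<bullet> (z - y)}"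

definition prox :: "real \<Rightarrow> ('a::real_inner \<Rightarrow> real) \<Rightarrow> 'a \<Rightarrow> 'a" where
  "prox \<mu> g v = (ARG_MIN (\<lambda>y. g y + 1 / (2 * \<mu>) * (norm (y - v))\<^sup>2) y. True)"

definition cluster_point :: "(nat \<Rightarrow> 'a::topological_space) \<Rightarrow> 'a \<Rightarrow> bool" where
  "cluster_point s w \<longleftrightarrow> (\<exists>q. strict_mono q \<and> (s \<circ> q) \<longlonglongrightarrow> w)"

section \<open>The constrained problem\<close>

text \<open>An \<open>m \<times> r\<close> matrix has type \<open>real ^ 'r ^ 'm\<close>; on this type \<open>\<bullet>\<close> and \<open>norm\<close> are the Frobenius
  inner product and norm. The stacked matrix \<open>[X; Y]\<close> is the pair \<open>(X, Y)\<close>, since the inner product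
  of the product type is \<open>(X, Y) \<bullet> (X', Y') = X \<bullet> X' + Y \<bullet> Y'\<close>.\<close>

definition prod_manifold ::
  "(real ^ 'r ^ 'n) set \<Rightarrow> ((real ^ 'r ^ 'n) \<times> (real ^ 'r ^ 'd)) set" where
  "prod_manifold M = M \<times> UNIV"

definition objective ::
  "(real ^ 'r ^ 'n \<Rightarrow> real) \<Rightarrow> (real ^ 'r ^ 'd \<Rightarrow> real) \<Rightarrow>
   (real ^ 'r ^ 'n) \<times> (real ^ 'r ^ 'd) \<Rightarrow> real" where
  "objective f g W = f (fst W) + g (snd W)"

definition constr ::
  "real ^ 'n ^ 'd \<Rightarrow> (real ^ 'r ^ 'n) \<times> (real ^ 'r ^ 'd) \<Rightarrow> real ^ 'r ^ 'd" where
  "constr A W = A ** fst W - snd W"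

definition constr_grad ::
  "(real ^ 'r ^ 'n) set \<Rightarrow> real ^ 'n ^ 'd \<Rightarrow> (real ^ 'r ^ 'n) \<times> (real ^ 'r ^ 'd) \<Rightarrow>
   'd \<Rightarrow> 'r \<Rightarrow> (real ^ 'r ^ 'n) \<times> (real ^ 'r ^ 'd)" where
  "constr_grad M A W i j = rgrad (prod_manifold M) (\<lambda>W'. constr A W' $ i $ j) W"

text \<open>Linear independence of the constraint gradients as a family indexed by \<open>(i, j)\<close>.\<close>

definition LICQ ::
  "(real ^ 'r ^ 'n) set \<Rightarrow> real ^ 'n ^ 'd \<Rightarrow> (real ^ 'r ^ 'n) \<times> (real ^ 'r ^ 'd) \<Rightarrow> bool" where
  "LICQ M A W \<longleftrightarrow>
     inj (\<lambda>(i, j). constr_grad M A W i j) \<and>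
     independent (range (\<lambda>(i, j). constr_grad M A W i j))"

definition KKT_point ::
  "(real ^ 'r ^ 'n) set \<Rightarrow> (real ^ 'r ^ 'n \<Rightarrow> real) \<Rightarrow> (real ^ 'r ^ 'd \<Rightarrow> real) \<Rightarrow>
   real ^ 'n ^ 'd \<Rightarrow> (real ^ 'r ^ 'n) \<times> (real ^ 'r ^ 'd) \<Rightarrow> bool" where
  "KKT_point M f g A W \<longleftrightarrow>
     W \<in> prod_manifold M \<and> constr A W = 0 \<and>
     (\<exists>Z :: real ^ 'r ^ 'd.
        0 \<in> {\<xi> + (\<Sum>i\<in>UNIV. \<Sum>j\<in>UNIV. Z $ i $ j *\<^sub>R constr_grad M A W i j) | \<xi>.
              \<xi> \<in> rclarke_subdiff (prod_manifold M) (objective f g) W})"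

section \<open>The manifold inexact augmented Lagrangian method\<close>

definition aug_lagrangian ::
  "(real ^ 'r ^ 'n \<Rightarrow> real) \<Rightarrow> (real ^ 'r ^ 'd \<Rightarrow> real) \<Rightarrow> real ^ 'n ^ 'd \<Rightarrow> real \<Rightarrow>
   real ^ 'r ^ 'n \<Rightarrow> real ^ 'r ^ 'd \<Rightarrow> real ^ 'r ^ 'd \<Rightarrow> real" where
  "aug_lagrangian f g A \<rho> X Y Z =
     f X + g Y - Z \<bullet> (A ** X - Y) + \<rho> / 2 * (norm (A ** X - Y))\<^sup>2"

definition reduced_lagrangian ::
  "(real ^ 'r ^ 'n \<Rightarrow> real) \<Rightarrow> (real ^ 'r ^ 'd \<Rightarrow> real) \<Rightarrow> real ^ 'n ^ 'd \<Rightarrow> real \<Rightarrow>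
   real ^ 'r ^ 'd \<Rightarrow> real ^ 'r ^ 'n \<Rightarrow> real" where
  "reduced_lagrangian f g A \<rho> Z X = (INF Y. aug_lagrangian f g A \<rho> X Y Z)"

definition entry_max_norm :: "real ^ 'r ^ 'd \<Rightarrow> real" where
  "entry_max_norm B = Max (range (\<lambda>(i, j). \<bar>B $ i $ j\<bar>))"

definition matrix_box :: "real ^ 'r ^ 'd \<Rightarrow> real ^ 'r ^ 'd \<Rightarrow> (real ^ 'r ^ 'd) set" where
  "matrix_box Zmin Zmax = {Z. \<forall>i j. Zmin $ i $ j \<le> Z $ i $ j \<and> Z $ i $ j \<le> Zmax $ i $ j}"

text \<open>The update rules of the method. The sense in which \<open>X (Suc k)\<close> approximately minimizes the
  reduced Lagrangian over \<open>M\<close> is left open here: it is a separate requirement on a generated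
  sequence.\<close>

definition MIALM ::
  "(real ^ 'r ^ 'n) set \<Rightarrow> (real ^ 'r ^ 'd \<Rightarrow> real) \<Rightarrow> real ^ 'n ^ 'd \<Rightarrow>
   real ^ 'r ^ 'd \<Rightarrow> real ^ 'r ^ 'd \<Rightarrow> real \<Rightarrow> real \<Rightarrow>
   (nat \<Rightarrow> real ^ 'r ^ 'n) \<Rightarrow> (nat \<Rightarrow> real ^ 'r ^ 'd) \<Rightarrow>
   (nat \<Rightarrow> real ^ 'r ^ 'd) \<Rightarrow> (nat \<Rightarrow> real ^ 'r ^ 'd) \<Rightarrow> (nat \<Rightarrow> real) \<Rightarrow> bool" where
  "MIALM M g A Zmin Zmax \<sigma> \<tau> X Y Z Zbar \<rho> \<longleftrightarrow>
     X 0 \<in> M \<and>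
     (\<forall>k. X (Suc k) \<in> M \<and>
          Y (Suc k) = prox (1 / \<rho> k) g (A ** X (Suc k) - (1 / \<rho> k) *\<^sub>R Zbar k) \<and>
          Z (Suc k) = Zbar k - \<rho> k *\<^sub>R (A ** X (Suc k) - Y (Suc k)) \<and>
          Zbar (Suc k) = closest_point (matrix_box Zmin Zmax) (Z (Suc k)) \<and>
          \<rho> (Suc k) =
            (if entry_max_norm (A ** X (Suc k) - Y (Suc k))
                  \<le> \<tau> * entry_max_norm (A ** X k - Y k)
             then \<rho> k else \<sigma> * \<rho> k))"

end

theory Submission
  imports Defs
begin

text \<open>Two facts drive the convergence.

  First, all multipliers produced by the method are subgradients up to sign. By optimality of the
  proximal step, \<open>- Z (Suc k) \<in> subdiff g (Y (Suc k))\<close> (\<open>MIALM_multiplier_subgradient\<close>), so the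
  multipliers are bounded because the subdifferentials are, and by the multiplier update so is
  \<open>\<rho> k *\<^sub>R (A ** X (Suc k) - Y (Suc k))\<close>. Either the penalty parameter eventually stops growing, and
  then the test in the penalty update makes the residual decay geometrically, or it tends to
  infinity, and then the bound makes the residual vanish (\<open>residual_tendsto_0\<close>). Hence
  \<open>A ** X k - Y k\<close> tends to 0, compactness of \<open>M\<close> gives a cluster point, and every cluster point is
  feasible.

  Second, the reduced Lagrangian is \<open>f\<close> plus a Moreau envelope of \<open>g\<close> composed with \<open>A\<close>. The
  envelope is squeezed between its tangent plane and that plane plus a quadratic, so it is
  differentiable, and the Riemannian gradient at \<open>X (Suc k)\<close> represents the functional
  \<open>v \<mapsto> Df(X (Suc k))[v] - Z (Suc k) \<bullet> (A ** v)\<close> on the tangent space (\<open>MIALM_rgrad\<close>). Along a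
  subsequence on which the multipliers converge to some \<open>z\<close>, the gradient vanishes in the limit. A
  slice chart carries each tangent vector at the cluster point to tangent vectors at the nearby
  iterates that converge to it, so \<open>Df[v] = z \<bullet> (A ** v)\<close> for every tangent vector \<open>v\<close> at the
  cluster point (\<open>stationarity_limit\<close>), while \<open>- z\<close> is a subgradient of \<open>g\<close> there by the closed
  graph of the subdifferential.

  It remains to read this as a KKT condition (\<open>KKT_pointI\<close>). Pairing the combination of constraint
  gradients with multiplier \<open>- z\<close> with a tangent vector gives a functional whose negative is
  \<open>v \<mapsto> Df[fst v] - z \<bullet> snd v\<close>. That negative is dominated by the generalized directional derivatives of
  the objective: it suffices to keep the base point fixed in the upper limit and to apply the
  subgradient inequality to \<open>g\<close> along the curve that the chart provides
  (\<open>rclarke_subdiff_sum\<close>).\<close>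

section \<open>Calculus of smooth maps\<close>

lemma has_derivative_local:
  assumes "open S" "x \<in> S" "\<And>y. y \<in> S \<Longrightarrow> f y = g y" "(f has_derivative f') (at x)"
  shows "(g has_derivative f') (at x)"
  using assms(4,1,2,3) by (rule has_derivative_transform_within_open)

lemma Ck_on_cong:
  assumes "open S" "\<And>x. x \<in> S \<Longrightarrow> f x = g x" "Ck_on k S f"
  shows "Ck_on k S g"
  using assms(2,3)
proof (induction k arbitrary: f g)
  case 0
  then show ?case by (simp cong: continuous_on_cong)
next
  case (Suc k)
  have D: "(g has_derivative frechet_derivative f (at x)) (at x)" if "x \<in> S" for x
    using has_derivative_local[OF assms(1) that Suc.prems(1)] Suc.prems(2) that
    by (auto simp: frechet_derivative_works)
  have "Ck_on k S (\<lambda>x. frechet_derivative g (at x) v)" for v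
  proof (rule Suc.IH)
    show "frechet_derivative f (at x) v = frechet_derivative g (at x) v" if "x \<in> S" for x
      using frechet_derivative_at[OF D[OF that]] by simp
    show "Ck_on k S (\<lambda>x. frechet_derivative f (at x) v)"
      using Suc.prems(2) by simp
  qed
  with D show ?case by (auto simp: differentiable_def)
qed

lemma Ck_on_linear_comp:
  assumes "open S" "bounded_linear L" "Ck_on k S f"
  shows "Ck_on k S (\<lambda>x. L (f x))"
  using assms(3)
proof (induction k arbitrary: f)
  case 0
  then show ?case using bounded_linear.continuous_on[OF assms(2)] by simp
next
  case (Suc k)
  have D: "((\<lambda>x. L (f x)) has_derivative (\<lambda>v. L (frechet_derivative f (at x) v))) (at x)"
    if "x \<in> S" for x
    using Suc.prems that
    by (auto intro!: bounded_linear.has_derivative[OF assms(2)] simp: frechet_derivative_works[symmetric])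
  have "Ck_on k S (\<lambda>x. frechet_derivative (\<lambda>x. L (f x)) (at x) v)" for v
  proof (rule Ck_on_cong[OF assms(1)])
    show "Ck_on k S (\<lambda>x. L (frechet_derivative f (at x) v))"
      using Suc.prems by (intro Suc.IH) simp
  qed (use frechet_derivative_at[OF D] in \<open>auto simp: fun_eq_iff\<close>)
  with D show ?case by (auto simp: differentiable_def)
qed

text \<open>This much of the chain rule suffices for curves that are straight lines in a chart: the derivative
  of the inner map is constant, so the induction never meets a product of functions.\<close>

lemma Ck_on_affine_precomp:
  assumes "open T" "bounded_linear L" "\<And>t. t \<in> T \<Longrightarrow> a + L t \<in> S" "Ck_on k S f"
  shows "Ck_on k T (\<lambda>t. f (a + L t))"
  using assms(4)
proof (induction k arbitrary: f)
  case 0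
  then show ?case
    using assms(3) by (auto intro!: continuous_on_compose2[of S f]
        continuous_intros bounded_linear.continuous_on[OF assms(2)])
next
  case (Suc k)
  have D: "((\<lambda>t. f (a + L t)) has_derivative (\<lambda>v. frechet_derivative f (at (a + L t)) (L v))) (at t)"
    if "t \<in> T" for t
  proof (rule has_derivative_compose[of "\<lambda>t. a + L t" L])
    show "((\<lambda>t. a + L t) has_derivative L) (at t)"
      using bounded_linear_imp_has_derivative[OF assms(2), of "at t"]
      by (auto intro: derivative_eq_intros)
    show "(f has_derivative frechet_derivative f (at (a + L t))) (at (a + L t))"
      using Suc.prems assms(3)[OF that] by (simp add: frechet_derivative_works[symmetric])
  qed
  have "Ck_on k T (\<lambda>t. frechet_derivative (\<lambda>t. f (a + L t)) (at t) v)" for v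
  proof (rule Ck_on_cong[OF assms(1)])
    show "Ck_on k T (\<lambda>t. frechet_derivative f (at (a + L t)) (L v))"
      using Suc.prems Suc.IH[of "\<lambda>x. frechet_derivative f (at x) (L v)"] by simp
  qed (use frechet_derivative_at[OF D] in \<open>auto simp: fun_eq_iff\<close>)
  with D show ?case by (auto simp: differentiable_def)
qed

lemma Ck_on_const: "Ck_on k S (\<lambda>x. c)"
  by (induction k arbitrary: c) auto

lemma Ck_on_ident: "Ck_on k S (\<lambda>x. x)"
  by (cases k) (auto simp: Ck_on_const)

lemma Ck_on_Pair:
  assumes "open S" "Ck_on k S f" "Ck_on k S g"
  shows "Ck_on k S (\<lambda>x. (f x, g x))"
  using assms(2,3)
proof (induction k arbitrary: f g)
  case 0
  then show ?case by (simp add: continuous_on_Pair)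
next
  case (Suc k)
  have D: "((\<lambda>x. (f x, g x)) has_derivative
      (\<lambda>v. (frechet_derivative f (at x) v, frechet_derivative g (at x) v))) (at x)"
    if "x \<in> S" for x
    using Suc.prems that
    by (auto intro!: has_derivative_Pair simp: frechet_derivative_works[symmetric])
  have "Ck_on k S (\<lambda>x. frechet_derivative (\<lambda>x. (f x, g x)) (at x) v)" for v
  proof (rule Ck_on_cong[OF assms(1)])
    show "Ck_on k S (\<lambda>x. (frechet_derivative f (at x) v, frechet_derivative g (at x) v))"
      using Suc.prems by (intro Suc.IH) simp_all
  qed (use frechet_derivative_at[OF D] in \<open>auto simp: fun_eq_iff\<close>)
  with D show ?case by (auto simp: differentiable_def)
qed

lemma smooth_on_has_derivative:
  assumes "smooth_on S f" "x \<in> S"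
  shows "(f has_derivative frechet_derivative f (at x)) (at x)"
proof -
  have "Ck_on (Suc 0) S f" using assms(1) by (simp only: smooth_on_def)
  with assms(2) show ?thesis by (simp add: frechet_derivative_works[symmetric])
qed

lemma smooth_on_derivative_continuous:
  assumes "smooth_on S f"
  shows "continuous_on S (\<lambda>x. frechet_derivative f (at x) v)"
proof -
  have "Ck_on (Suc 0) S f" using assms by (simp only: smooth_on_def)
  then show ?thesis by simp
qed

text \<open>The derivative is jointly continuous in the base point and the direction: by linearity it is a
  finite combination of the directional derivatives along basis vectors, each of which is
  continuous.\<close>

lemma smooth_on_derivative_tendsto:
  fixes f :: "'a::euclidean_space \<Rightarrow> 'b::euclidean_space"
  assumes "smooth_on S f" "open S" "x \<in> S" "(y \<longlongrightarrow> x) F" "(w \<longlongrightarrow> v) F"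
  shows "((\<lambda>n. frechet_derivative f (at (y n)) (w n)) \<longlongrightarrow> frechet_derivative f (at x) v) F"
proof -
  have expand: "frechet_derivative f (at p) u = (\<Sum>b\<in>Basis. (u \<bullet> b) *\<^sub>R frechet_derivative f (at p) b)"
    if "p \<in> S" for p u
  proof -
    interpret linear "frechet_derivative f (at p)"
      using smooth_on_has_derivative[OF assms(1) that] has_derivative_linear by blast
    have "frechet_derivative f (at p) u = frechet_derivative f (at p) (\<Sum>b\<in>Basis. (u \<bullet> b) *\<^sub>R b)"
      by (simp add: euclidean_representation)
    then show ?thesis by (simp add: sum scale)
  qed
  have "((\<lambda>n. \<Sum>b\<in>Basis. (w n \<bullet> b) *\<^sub>R frechet_derivative f (at (y n)) b)
      \<longlongrightarrow> (\<Sum>b\<in>Basis. (v \<bullet> b) *\<^sub>R frechet_derivative f (at x) b)) F"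
    using smooth_on_derivative_continuous[OF assms(1)] assms(2-5)
    by (intro tendsto_intros) (auto simp: continuous_on_eq_continuous_at intro: isCont_tendsto_compose)
  moreover have "\<forall>\<^sub>F n in F. y n \<in> S"
    using assms(2-4) by (rule topological_tendstoD[rotated])
  then have "\<forall>\<^sub>F n in F. (\<Sum>b\<in>Basis. (w n \<bullet> b) *\<^sub>R frechet_derivative f (at (y n)) b)
      = frechet_derivative f (at (y n)) (w n)"
    by eventually_elim (simp add: expand[symmetric])
  ultimately show ?thesis
    unfolding expand[OF assms(3), of v] by (rule Lim_transform_eventually)
qed

section \<open>Tangent spaces and Riemannian gradients\<close>

lemma slice_chart_move: "slice_chart M x U \<Phi> \<Psi> S \<Longrightarrow> y \<in> U \<Longrightarrow> slice_chart M y U \<Phi> \<Psi> S"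
  by (simp add: slice_chart_def)

lemma slice_chartD:
  assumes "slice_chart M x U \<Phi> \<Psi> S"
  shows "open U" "x \<in> U" "open (\<Phi> ` U)" "subspace S" "\<And>y. y \<in> U \<Longrightarrow> \<Psi> (\<Phi> y) = y"
    and "\<Phi> ` (M \<inter> U) = \<Phi> ` U \<inter> S"
    and "smooth_on U \<Phi>" "smooth_on (\<Phi> ` U) \<Psi>"
  using assms unfolding slice_chart_def by blast+

lemma slice_chart_derivatives:
  assumes "slice_chart M x U \<Phi> \<Psi> S"
  shows "(\<Phi> has_derivative frechet_derivative \<Phi> (at x)) (at x)"
    and "(\<Psi> has_derivative frechet_derivative \<Psi> (at (\<Phi> x))) (at (\<Phi> x))"
  using slice_chartD[OF assms] by (meson smooth_on_has_derivative imageI)+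

lemma slice_chart_derivative_inverse:
  assumes "slice_chart M x U \<Phi> \<Psi> S"
  shows "frechet_derivative \<Psi> (at (\<Phi> x)) (frechet_derivative \<Phi> (at x) v) = v"
proof -
  note c = slice_chartD[OF assms]
  have comp: "((\<lambda>y. \<Psi> (\<Phi> y)) has_derivative
      (\<lambda>v. frechet_derivative \<Psi> (at (\<Phi> x)) (frechet_derivative \<Phi> (at x) v))) (at x)"
    using slice_chart_derivatives[OF assms] by (rule has_derivative_compose)
  have ident: "((\<lambda>y. \<Psi> (\<Phi> y)) has_derivative (\<lambda>v. v)) (at x)"
    by (rule has_derivative_local[OF c(1,2), of "\<lambda>x. x"]) (simp_all add: c(5))
  from fun_cong[OF has_derivative_unique[OF comp ident]] show ?thesis .
qed

text \<open>Along a curve in \<open>M\<close> the chart stays in the subspace \<open>S\<close>, so its velocity pairs to 0 with the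
  component of that velocity orthogonal to \<open>S\<close>.\<close>

lemma slice_chart_tangent_in_slice:
  assumes chart: "slice_chart M x U \<Phi> \<Psi> S" and v: "v \<in> tangent_space M x"
  shows "frechet_derivative \<Phi> (at x) v \<in> S"
proof -
  note c = slice_chartD[OF chart]
  obtain \<gamma> e where "e > 0" and \<gamma>: "smooth_on {-e<..<e} \<gamma>" and \<gamma>M: "\<gamma> ` {-e<..<e} \<subseteq> M"
    and \<gamma>0: "\<gamma> 0 = x" and d\<gamma>: "(\<gamma> has_vector_derivative v) (at 0)"
    using v unfolding tangent_space_def curve_through_def by blast
  let ?w = "frechet_derivative \<Phi> (at x) v"
  have "((\<lambda>t. \<Phi> (\<gamma> t)) has_derivative (\<lambda>t. frechet_derivative \<Phi> (at x) (t *\<^sub>R v))) (at 0)"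
  proof (rule has_derivative_compose[of \<gamma> "\<lambda>t. t *\<^sub>R v" 0 UNIV \<Phi>])
    show "(\<gamma> has_derivative (\<lambda>t. t *\<^sub>R v)) (at 0)"
      using d\<gamma> by (simp only: has_vector_derivative_def)
    show "(\<Phi> has_derivative frechet_derivative \<Phi> (at x)) (at (\<gamma> 0))"
      unfolding \<gamma>0 by (rule slice_chart_derivatives(1)[OF chart])
  qed
  moreover have "linear (frechet_derivative \<Phi> (at x))"
    using slice_chart_derivatives(1)[OF chart] by (rule has_derivative_linear)
  ultimately have D: "((\<lambda>t. \<Phi> (\<gamma> t)) has_vector_derivative ?w) (at 0)"
    by (simp add: has_vector_derivative_def linear_cmul)
  obtain y z where y: "y \<in> span S" and z: "\<And>w. w \<in> span S \<Longrightarrow> orthogonal z w" and yz: "?w = y + z"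
    using orthogonal_subspace_decomp_exists by blast
  have D1: "((\<lambda>t. \<Phi> (\<gamma> t) \<bullet> z) has_vector_derivative ?w \<bullet> z) (at 0)"
    by (rule bounded_linear.has_vector_derivative[OF bounded_linear_inner_left D])
  have D2: "((\<lambda>t. \<Phi> (\<gamma> t) \<bullet> z) has_vector_derivative 0) (at 0)"
  proof (rule has_vector_derivative_transform_within_open[of "\<lambda>t. 0"])
    have "continuous_on {-e<..<e} \<gamma>"
      using \<gamma> unfolding smooth_on_def by (auto dest: spec[of _ "0::nat"])
    then show "open ({-e<..<e} \<inter> \<gamma> -` U)"
      using c(1) by (intro continuous_open_preimage) auto
    show "0 \<in> {-e<..<e} \<inter> \<gamma> -` U" using \<open>e > 0\<close> \<gamma>0 c(2) by simp
    show "0 = \<Phi> (\<gamma> t) \<bullet> z" if "t \<in> {-e<..<e} \<inter> \<gamma> -` U" for t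
    proof -
      have "\<gamma> t \<in> M \<inter> U" using that \<gamma>M by auto
      then have "\<Phi> (\<gamma> t) \<in> S" using c(6) by blast
      then show ?thesis using z[of "\<Phi> (\<gamma> t)"] by (simp add: span_base orthogonal_def inner_commute)
    qed
  qed auto
  from vector_derivative_unique_at[OF D1 D2] have "?w \<bullet> z = 0" .
  moreover have "y \<bullet> z = 0" using z[OF y] by (simp add: orthogonal_def inner_commute)
  ultimately have "z = 0" using yz by (simp add: inner_add_left)
  then have "?w = y" using yz by simp
  moreover have "span S = S" using c(4) by (rule span_eq_iff[THEN iffD2])
  ultimately show ?thesis using y by metis
qed

text \<open>Lines inside the slice, pulled back by the chart, are curves in \<open>M\<close> near time 0. They realize all
  tangent vectors, and they are also the curves along which the generalized directional derivative
  is defined.\<close>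

lemma slice_chart_curve:
  assumes chart: "slice_chart M x U \<Phi> \<Psi> S" and x: "x \<in> M" and s: "s \<in> S"
  shows "curve_through M x (frechet_derivative \<Psi> (at (\<Phi> x)) s) (\<lambda>t. \<Psi> (\<Phi> x + t *\<^sub>R s))"
proof -
  note c = slice_chartD[OF chart]
  have lin: "bounded_linear (\<lambda>t. t *\<^sub>R s)" by (rule bounded_linear_scaleR_left)
  have "open ((\<lambda>t. \<Phi> x + t *\<^sub>R s) -` (\<Phi> ` U))"
    by (rule open_vimage[OF c(3)]) (intro continuous_intros)
  moreover have "0 \<in> (\<lambda>t. \<Phi> x + t *\<^sub>R s) -` (\<Phi> ` U)" using c(2) by simp
  ultimately obtain e where "e > 0" and e: "ball 0 e \<subseteq> (\<lambda>t. \<Phi> x + t *\<^sub>R s) -` (\<Phi> ` U)"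
    using open_contains_ball by blast
  have inU: "\<Phi> x + t *\<^sub>R s \<in> \<Phi> ` U" if "t \<in> {-e<..<e}" for t
    using e that by (auto simp: ball_eq_greaterThanLessThan)
  have "smooth_on {-e<..<e} (\<lambda>t. \<Psi> (\<Phi> x + t *\<^sub>R s))"
    unfolding smooth_on_def
  proof
    show "Ck_on k {-e<..<e} (\<lambda>t. \<Psi> (\<Phi> x + t *\<^sub>R s))" for k
      using c(8) inU by (intro Ck_on_affine_precomp[OF _ lin, where S = "\<Phi> ` U"]) (simp_all add: smooth_on_def)
  qed
  moreover have "\<Psi> (\<Phi> x + t *\<^sub>R s) \<in> M" if "t \<in> {-e<..<e}" for t
  proof -
    have "\<Phi> x \<in> S" using c(2,6) x by blast
    then have "\<Phi> x + t *\<^sub>R s \<in> S" using s c(4) by (simp add: subspace_add subspace_scale)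
    then have "\<Phi> x + t *\<^sub>R s \<in> \<Phi> ` (M \<inter> U)" using inU[OF that] c(6) by blast
    then show ?thesis using c(5) by auto
  qed
  moreover have "((\<lambda>t. \<Psi> (\<Phi> x + t *\<^sub>R s)) has_vector_derivative
      frechet_derivative \<Psi> (at (\<Phi> x)) s) (at 0)"
  proof -
    have "((\<lambda>t. \<Psi> (\<Phi> x + t *\<^sub>R s)) has_derivative
        (\<lambda>t. frechet_derivative \<Psi> (at (\<Phi> x)) (t *\<^sub>R s))) (at 0)"
    proof (rule has_derivative_compose[of "\<lambda>t. \<Phi> x + t *\<^sub>R s" "\<lambda>t. t *\<^sub>R s" 0 UNIV \<Psi>])
      show "((\<lambda>t. \<Phi> x + t *\<^sub>R s) has_derivative (\<lambda>t. t *\<^sub>R s)) (at 0)"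
        by (auto intro!: derivative_eq_intros)
      show "(\<Psi> has_derivative frechet_derivative \<Psi> (at (\<Phi> x))) (at (\<Phi> x + 0 *\<^sub>R s))"
        using slice_chart_derivatives(2)[OF chart] by simp
    qed
    moreover have "linear (frechet_derivative \<Psi> (at (\<Phi> x)))"
      using slice_chart_derivatives(2)[OF chart] by (rule has_derivative_linear)
    ultimately show ?thesis by (simp add: has_vector_derivative_def linear_cmul)
  qed
  moreover have "\<Psi> (\<Phi> x + 0 *\<^sub>R s) = x" using c(2,5) by simp
  ultimately show ?thesis unfolding curve_through_def using \<open>e > 0\<close> by blast
qed

text \<open>Reading tangent vectors in a chart makes the tangent space a linear subspace, and shows how to move
  tangent vectors between nearby points: the same \<open>s \<in> S\<close> can be used at every point of the chart.\<close>

lemma tangent_space_slice_chart: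
  assumes chart: "slice_chart M x U \<Phi> \<Psi> S" and x: "x \<in> M"
  shows "tangent_space M x = frechet_derivative \<Psi> (at (\<Phi> x)) ` S"
proof (intro equalityI subsetI)
  fix v assume "v \<in> tangent_space M x"
  from slice_chart_tangent_in_slice[OF chart this] slice_chart_derivative_inverse[OF chart, of v]
  show "v \<in> frechet_derivative \<Psi> (at (\<Phi> x)) ` S" by (metis imageI)
next
  fix v assume "v \<in> frechet_derivative \<Psi> (at (\<Phi> x)) ` S"
  then show "v \<in> tangent_space M x"
    using slice_chart_curve[OF chart x] unfolding tangent_space_def by blast
qed

lemma subspace_tangent_space:
  assumes "embedded_submanifold M" "x \<in> M"
  shows "subspace (tangent_space M x)"
proof -
  obtain U \<Phi> \<Psi> S where chart: "slice_chart M x U \<Phi> \<Psi> S"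
    using assms unfolding embedded_submanifold_def by blast
  have "linear (frechet_derivative \<Psi> (at (\<Phi> x)))"
    using slice_chart_derivatives(2)[OF chart] by (rule has_derivative_linear)
  then show ?thesis
    unfolding tangent_space_slice_chart[OF chart assms(2)]
    using slice_chartD(4)[OF chart] by (rule linear_subspace_image)
qed

lemma has_rgrad_unique:
  assumes sub: "subspace (tangent_space M x)" and "has_rgrad M F x \<xi>" "has_rgrad M F x \<eta>"
  shows "\<xi> = \<eta>"
proof -
  have T: "\<xi> \<in> tangent_space M x" "\<eta> \<in> tangent_space M x"
    using assms(2,3) by (auto simp: has_rgrad_def)
  then have "\<xi> - \<eta> \<in> tangent_space M x" using sub by (simp add: subspace_diff)
  then obtain c where "curve_through M x (\<xi> - \<eta>) c" by (auto simp: tangent_space_def)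
  then have "\<xi> \<bullet> (\<xi> - \<eta>) = \<eta> \<bullet> (\<xi> - \<eta>)"
    using assms(2,3) unfolding has_rgrad_def by (meson DERIV_unique)
  then have "(\<xi> - \<eta>) \<bullet> (\<xi> - \<eta>) = 0" by (simp add: inner_diff_left)
  then show ?thesis by simp
qed

text \<open>Existence of the gradient: represent the functional by an ambient vector (Riesz) and project it
  orthogonally to the tangent space.\<close>

lemma rgrad_characterization:
  assumes sub: "subspace (tangent_space M x)" and lin: "linear D"
    and D: "\<And>v c. curve_through M x v c \<Longrightarrow> ((\<lambda>t. F (c t)) has_real_derivative D v) (at 0)"
  shows "rgrad M F x \<in> tangent_space M x" "\<And>v. v \<in> tangent_space M x \<Longrightarrow> rgrad M F x \<bullet> v = D v"
proof -
  obtain y z where y: "y \<in> span (tangent_space M x)"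
    and z: "\<And>w. w \<in> span (tangent_space M x) \<Longrightarrow> orthogonal z w"
    and yz: "adjoint D 1 = y + z"
    using orthogonal_subspace_decomp_exists by blast
  have yD: "y \<bullet> v = D v" if "v \<in> tangent_space M x" for v
  proof -
    have "D v = v \<bullet> adjoint D 1" using adjoint_works[OF lin, of v 1] by simp
    also have "\<dots> = y \<bullet> v"
      using z[OF span_base[OF that]] yz by (simp add: inner_add_right orthogonal_def inner_commute)
    finally show ?thesis by simp
  qed
  have "y \<in> tangent_space M x" using y sub by (metis span_eq_iff)
  moreover have "((\<lambda>t. F (c t)) has_real_derivative y \<bullet> v) (at 0)" if "curve_through M x v c" for v c
  proof -
    have "v \<in> tangent_space M x" using that by (auto simp: tangent_space_def)
    from D[OF that] yD[OF this] show ?thesis by simp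
  qed
  ultimately have "has_rgrad M F x y" by (simp add: has_rgrad_def)
  then have "has_rgrad M F x (rgrad M F x)"
    unfolding rgrad_def by (metis has_rgrad_unique[OF sub] theI)
  from has_rgrad_unique[OF sub this \<open>has_rgrad M F x y\<close>] have "rgrad M F x = y" .
  with yD \<open>y \<in> tangent_space M x\<close>
  show "rgrad M F x \<in> tangent_space M x" "\<And>v. v \<in> tangent_space M x \<Longrightarrow> rgrad M F x \<bullet> v = D v"
    by simp_all
qed

lemma curve_through_fst:
  assumes "curve_through (M \<times> UNIV) W v c"
  shows "curve_through M (fst W) (fst v) (\<lambda>t. fst (c t))"
proof -
  obtain e where e: "e > 0" and c: "smooth_on {-e<..<e} c" "c ` {-e<..<e} \<subseteq> M \<times> UNIV"
    "c 0 = W" "(c has_vector_derivative v) (at 0)"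
    using assms unfolding curve_through_def by blast
  have "smooth_on {-e<..<e} (\<lambda>t. fst (c t))"
    using c(1) unfolding smooth_on_def
    by (blast intro: Ck_on_linear_comp[OF _ bounded_linear_fst] open_greaterThanLessThan)
  moreover have "((\<lambda>t. fst (c t)) has_vector_derivative fst v) (at 0)"
    by (rule bounded_linear.has_vector_derivative[OF bounded_linear_fst c(4)])
  ultimately show ?thesis
    unfolding curve_through_def using e c(2,3)
    by (intro conjI exI[of _ e]) (simp_all add: image_subset_iff mem_Times_iff)
qed

lemma tangent_space_times_UNIV:
  fixes x :: "'a::euclidean_space" and y :: "'b::euclidean_space"
  shows "tangent_space (M \<times> UNIV) (x, y) = tangent_space M x \<times> UNIV"
proof (intro equalityI subsetI)
  fix v assume "v \<in> tangent_space (M \<times> (UNIV :: 'b set)) (x, y)"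
  then obtain c where "curve_through (M \<times> UNIV) (x, y) v c" by (auto simp: tangent_space_def)
  from curve_through_fst[OF this] have "curve_through M x (fst v) (\<lambda>t. fst (c t))" by simp
  then show "v \<in> tangent_space M x \<times> UNIV" by (auto simp: tangent_space_def mem_Times_iff)
next
  fix v assume "v \<in> tangent_space M x \<times> (UNIV :: 'b set)"
  then obtain c e where e: "e > 0" and c: "smooth_on {-e<..<e} c" "c ` {-e<..<e} \<subseteq> M"
    "c 0 = x" "(c has_vector_derivative fst v) (at 0)"
    unfolding tangent_space_def curve_through_def by (auto simp: mem_Times_iff)
  have "smooth_on {-e<..<e} (\<lambda>t. (c t, y + t *\<^sub>R snd v))"
    unfolding smooth_on_def
  proof
    fix k
    have "Ck_on k {-e<..<e} (\<lambda>t. y + t *\<^sub>R snd v)"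
      by (rule Ck_on_affine_precomp[where f = "\<lambda>z. z" and S = UNIV])
        (auto intro: bounded_linear_scaleR_left Ck_on_ident)
    then show "Ck_on k {-e<..<e} (\<lambda>t. (c t, y + t *\<^sub>R snd v))"
      using c(1) by (auto simp: smooth_on_def intro!: Ck_on_Pair)
  qed
  moreover have "((\<lambda>t. (c t, y + t *\<^sub>R snd v)) has_vector_derivative v) (at 0)"
  proof -
    have "((\<lambda>t. y + t *\<^sub>R snd v) has_vector_derivative snd v) (at 0)"
      by (auto intro!: derivative_eq_intros)
    from has_vector_derivative_Pair[OF c(4) this] show ?thesis by simp
  qed
  ultimately have "curve_through (M \<times> UNIV) (x, y) v (\<lambda>t. (c t, y + t *\<^sub>R snd v))"
    unfolding curve_through_def using e c(2,3) by (intro conjI exI[of _ e]) (simp_all add: image_subset_iff)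
  then show "v \<in> tangent_space (M \<times> UNIV) (x, y)" by (auto simp: tangent_space_def)
qed

section \<open>Proximal steps and the Moreau envelope\<close>

text \<open>Compare \<open>g\<close> on a ray from \<open>v\<close> with its minimum over the unit sphere around \<open>v\<close>: convexity keeps
  the slope along the ray from dropping below what is seen at distance 1. This is what makes the
  proximal objective coercive.\<close>

lemma convex_linear_lower_bound:
  fixes g :: "'a::euclidean_space \<Rightarrow> real"
  assumes cvx: "convex_on UNIV g"
  obtains c where "c \<ge> 0" "\<And>y. norm (y - v) \<ge> 1 \<Longrightarrow> g y \<ge> g v - c * norm (y - v)"
proof -
  have "compact (sphere v 1)" "sphere v 1 \<noteq> {}" by auto
  moreover have cont: "continuous_on (sphere v 1) g"
    using convex_on_continuous[OF open_UNIV cvx] continuous_on_subset by blast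
  ultimately obtain m where m: "\<And>u. u \<in> sphere v 1 \<Longrightarrow> g m \<le> g u"
    using continuous_attains_inf by metis
  have "g y \<ge> g v - max 0 (g v - g m) * norm (y - v)" if "norm (y - v) \<ge> 1" for y
  proof -
    let ?n = "norm (y - v)"
    have pos: "?n > 0" using that by linarith
    define u where "u = v + (1 / ?n) *\<^sub>R (y - v)"
    have "u \<in> sphere v 1" using pos by (simp add: u_def dist_norm)
    then have "g m \<le> g u" by (rule m)
    also have "u = (1 - 1 / ?n) *\<^sub>R v + (1 / ?n) *\<^sub>R y" by (simp add: u_def algebra_simps)
    also have "g \<dots> \<le> (1 - 1 / ?n) * g v + (1 / ?n) * g y"
      using that pos by (intro convex_onD[OF cvx]) (auto simp: divide_le_eq_1)
    finally have "?n * g m \<le> ?n * ((1 - 1 / ?n) * g v + (1 / ?n) * g y)"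
      using pos by (intro mult_left_mono) auto
    also have "\<dots> = ?n * g v - g v + g y" using pos by (simp add: field_simps)
    finally have "g v - (g v - g m) * ?n \<le> g y" by (simp add: algebra_simps)
    moreover have "(g v - g m) * ?n \<le> max 0 (g v - g m) * ?n"
      by (rule mult_right_mono) auto
    ultimately show ?thesis by linarith
  qed
  then show ?thesis using that[of "max 0 (g v - g m)"] by simp
qed

text \<open>The \<open>ARG_MIN\<close> in the definition of the proximal map is attained: outside a large ball
  the quadratic beats the linear decrease of \<open>g\<close>, and inside it continuity and compactness apply.\<close>

lemma prox_minimizes:
  fixes g :: "'a::euclidean_space \<Rightarrow> real"
  assumes cvx: "convex_on UNIV g" and "\<mu> > 0"
  shows "g (prox \<mu> g v) + 1 / (2 * \<mu>) * (norm (prox \<mu> g v - v))\<^sup>2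
      \<le> g y + 1 / (2 * \<mu>) * (norm (y - v))\<^sup>2"
proof -
  let ?q = "\<lambda>y. g y + 1 / (2 * \<mu>) * (norm (y - v))\<^sup>2"
  obtain c where c: "c \<ge> 0" "\<And>y. norm (y - v) \<ge> 1 \<Longrightarrow> g y \<ge> g v - c * norm (y - v)"
    using convex_linear_lower_bound[OF cvx] by blast
  \<comment> \<open>Beyond this radius \<open>(norm (y - v))\<^sup>2 / (2 * \<mu>)\<close> outweighs \<open>c * norm (y - v)\<close>.\<close>
  define R where "R = max 1 (2 * \<mu> * c)"
  then have "R > 0" by simp
  have "continuous_on UNIV g" by (rule convex_on_continuous[OF open_UNIV cvx])
  then have "continuous_on (cball v R) ?q"
    by (intro continuous_intros) (auto intro: continuous_on_subset)
  moreover have "compact (cball v R)" "cball v R \<noteq> {}" using \<open>R > 0\<close> by auto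
  ultimately have "\<exists>p\<in>cball v R. \<forall>y\<in>cball v R. ?q p \<le> ?q y"
    by (intro continuous_attains_inf)
  then obtain p where p: "\<And>y. y \<in> cball v R \<Longrightarrow> ?q p \<le> ?q y" by blast
  have "?q p \<le> ?q y" for y
  proof (cases "y \<in> cball v R")
    case False
    let ?n = "norm (y - v)"
    have n: "?n \<ge> 1" "?n \<ge> 2 * \<mu> * c"
      using False by (auto simp: R_def dist_norm norm_minus_commute)
    have "2 * \<mu> * c * ?n \<le> ?n * ?n" using n by (intro mult_right_mono) auto
    then have "c * ?n \<le> 1 / (2 * \<mu>) * ?n\<^sup>2"
      using \<open>\<mu> > 0\<close> by (simp add: field_simps power2_eq_square)
    with c(2)[OF n(1)] have "g v \<le> ?q y" by linarith
    moreover have "?q p \<le> ?q v" by (rule p) (simp add: R_def)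
    ultimately show ?thesis by simp
  qed (rule p)
  then have "is_arg_min ?q (\<lambda>y. True) p" by (simp add: is_arg_min_linorder)
  then have "is_arg_min ?q (\<lambda>y. True) (prox \<mu> g v)"
    unfolding prox_def arg_min_def by (rule someI)
  then show ?thesis by (simp add: is_arg_min_linorder)
qed

text \<open>Move from the minimizer \<open>p\<close> towards \<open>z\<close> by a fraction \<open>t\<close>: minimality and convexity leave an
  inequality of order \<open>t\<close> up to a quadratic error, which disappears after dividing by \<open>t\<close> and letting
  \<open>t \<rightarrow> 0\<close>.\<close>

lemma prox_subgradient:
  fixes g :: "'a::euclidean_space \<Rightarrow> real"
  assumes cvx: "convex_on UNIV g" and "\<mu> > 0"
  shows "(1 / \<mu>) *\<^sub>R (v - prox \<mu> g v) \<in> subdiff g (prox \<mu> g v)"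
  unfolding subdiff_def
proof safe
  fix z
  let ?p = "prox \<mu> g v"
  let ?d = "z - ?p"
  have step: "0 \<le> g z - g ?p + (1 / \<mu>) * ((?p - v) \<bullet> ?d) + t * (1 / (2 * \<mu>) * (norm ?d)\<^sup>2)"
    if t: "0 < t" "t < 1" for t
  proof -
    let ?K = "1 / (2 * \<mu>)"
    let ?r = "t * (2 * ((?p - v) \<bullet> ?d)) + t * t * (norm ?d)\<^sup>2"
    have "g ?p + ?K * (norm (?p - v))\<^sup>2 \<le> g (?p + t *\<^sub>R ?d) + ?K * (norm (?p + t *\<^sub>R ?d - v))\<^sup>2"
      by (rule prox_minimizes[OF assms])
    moreover have "g (?p + t *\<^sub>R ?d) \<le> g ?p + t * (g z - g ?p)"
    proof -
      have "?p + t *\<^sub>R ?d = (1 - t) *\<^sub>R ?p + t *\<^sub>R z" by (simp add: algebra_simps)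
      then have "g (?p + t *\<^sub>R ?d) \<le> (1 - t) * g ?p + t * g z"
        using convex_onD[OF cvx, of t ?p z] t by simp
      then show ?thesis by (simp add: algebra_simps)
    qed
    moreover have "?K * (norm (?p + t *\<^sub>R ?d - v))\<^sup>2 = ?K * (norm (?p - v))\<^sup>2 + ?K * ?r"
    proof -
      have "?p + t *\<^sub>R ?d - v = (?p - v) + t *\<^sub>R ?d" by simp
      then have "(norm (?p + t *\<^sub>R ?d - v))\<^sup>2 = (norm ((?p - v) + t *\<^sub>R ?d))\<^sup>2" by (rule arg_cong)
      also have "\<dots> = (norm (?p - v))\<^sup>2 + ?r"
        unfolding power2_norm_eq_inner
        by (simp only: inner_add_left inner_add_right inner_scaleR_left inner_scaleR_right
            inner_commute[of ?d "?p - v"]) (simp add: algebra_simps)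
      finally show ?thesis by (simp only: distrib_left)
    qed
    ultimately have "0 \<le> t * (g z - g ?p) + ?K * ?r" by linarith
    also have "\<dots> = t * (g z - g ?p + (1 / \<mu>) * ((?p - v) \<bullet> ?d) + t * (1 / (2 * \<mu>) * (norm ?d)\<^sup>2))"
      using \<open>\<mu> > 0\<close> by (simp add: field_simps)
    finally show ?thesis using t by (simp add: zero_le_mult_iff)
  qed
  have "((\<lambda>t. g z - g ?p + (1 / \<mu>) * ((?p - v) \<bullet> ?d) + t * (1 / (2 * \<mu>) * (norm ?d)\<^sup>2)) \<longlongrightarrow>
      g z - g ?p + (1 / \<mu>) * ((?p - v) \<bullet> ?d) + 0 * (1 / (2 * \<mu>) * (norm ?d)\<^sup>2)) (at_right 0)"
    by (intro tendsto_intros)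
  moreover have "\<forall>\<^sub>F t in at_right 0. 0 \<le> g z - g ?p + (1 / \<mu>) * ((?p - v) \<bullet> ?d) + t * (1 / (2 * \<mu>) * (norm ?d)\<^sup>2)"
    using step by (auto simp: eventually_at_right_field intro!: exI[of _ 1])
  ultimately have "0 \<le> g z - g ?p + (1 / \<mu>) * ((?p - v) \<bullet> ?d) + 0 * (1 / (2 * \<mu>) * (norm ?d)\<^sup>2)"
    by (intro tendsto_lowerbound) auto
  moreover have "(1 / \<mu>) *\<^sub>R (v - ?p) \<bullet> ?d = - ((1 / \<mu>) * ((?p - v) \<bullet> ?d))"
    by (simp add: inner_diff_left algebra_simps)
  ultimately show "g z \<ge> g ?p + (1 / \<mu>) *\<^sub>R (v - ?p) \<bullet> ?d" by simp
qed

lemma subdiff_closed_graph: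
  fixes g :: "'a::euclidean_space \<Rightarrow> real"
  assumes "convex_on UNIV g" "y \<longlonglongrightarrow> y'" "z \<longlonglongrightarrow> z'" "\<And>n. z n \<in> subdiff g (y n)"
  shows "z' \<in> subdiff g y'"
  unfolding subdiff_def
proof safe
  fix u
  have "isCont g y'"
    using convex_on_continuous[OF open_UNIV assms(1)] by (simp add: continuous_on_eq_continuous_at)
  then have "(\<lambda>n. g (y n)) \<longlonglongrightarrow> g y'" using assms(2) by (rule isCont_tendsto_compose)
  then have "(\<lambda>n. g (y n) + z n \<bullet> (u - y n)) \<longlonglongrightarrow> g y' + z' \<bullet> (u - y')"
    using assms(2,3) by (intro tendsto_intros)
  then show "g y' + z' \<bullet> (u - y') \<le> g u"
    by (rule LIMSEQ_le_const2) (use assms(4) in \<open>auto simp: subdiff_def\<close>)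
qed

text \<open>The infimum over \<open>Y\<close> of the augmented Lagrangian as a function of \<open>U = A ** X\<close>, without the term
  \<open>f X\<close>. Up to a shift of the argument and an additive constant it is the Moreau envelope of \<open>g\<close> with
  parameter \<open>1 / \<rho>\<close>.\<close>

definition envelope :: "('b::real_inner \<Rightarrow> real) \<Rightarrow> real \<Rightarrow> 'b \<Rightarrow> 'b \<Rightarrow> real" where
  "envelope g \<rho> Z U = (INF Y. g Y - Z \<bullet> (U - Y) + \<rho> / 2 * (norm (U - Y))\<^sup>2)"

text \<open>Add the subgradient inequality for \<open>g\<close> at \<open>Y0\<close> to the expansion of the quadratic around
  \<open>U0 - Y0\<close>: everything is affine in \<open>U\<close> except for a leftover square
  \<open>\<rho> / 2 * (norm ((U - Y) - (U0 - Y0)))\<^sup>2\<close>, which is dropped.\<close>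

lemma penalized_lower_bound:
  fixes g :: "'b::real_inner \<Rightarrow> real"
  assumes "\<rho> \<ge> 0" and G: "\<rho> *\<^sub>R (U0 - Y0) - Z \<in> subdiff g Y0"
  shows "g Y0 - Z \<bullet> (U0 - Y0) + \<rho> / 2 * (norm (U0 - Y0))\<^sup>2 + (\<rho> *\<^sub>R (U0 - Y0) - Z) \<bullet> (U - U0)
      \<le> g Y - Z \<bullet> (U - Y) + \<rho> / 2 * (norm (U - Y))\<^sup>2"
proof -
  define D D0 where "D = U - Y" and "D0 = U0 - Y0"
  have Y: "Y - Y0 = (U - U0) - (D - D0)" by (simp add: D_def D0_def)
  have "g Y0 + (\<rho> *\<^sub>R D0 - Z) \<bullet> (Y - Y0) \<le> g Y"
    using G by (simp add: subdiff_def D0_def)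
  then have "g Y0 + (\<rho> *\<^sub>R D0 - Z) \<bullet> (U - U0) - (\<rho> *\<^sub>R D0 - Z) \<bullet> (D - D0) \<le> g Y"
    unfolding Y by (simp add: inner_diff_right)
  moreover have "0 \<le> \<rho> / 2 * (norm (D - D0))\<^sup>2" using assms(1) by simp
  moreover have "- ((\<rho> *\<^sub>R D0 - Z) \<bullet> (D - D0)) - Z \<bullet> D + \<rho> / 2 * (norm D)\<^sup>2
      = - (Z \<bullet> D0) + \<rho> / 2 * (norm D0)\<^sup>2 + \<rho> / 2 * (norm (D - D0))\<^sup>2"
    unfolding power2_norm_eq_inner
    by (simp add: inner_diff_left inner_diff_right inner_commute algebra_simps)
  ultimately show ?thesis unfolding D_def[symmetric] D0_def[symmetric] by linarith
qed

lemma envelope_bdd_below: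
  fixes g :: "'b::real_inner \<Rightarrow> real"
  assumes "\<rho> \<ge> 0" and G: "\<rho> *\<^sub>R (U0 - Y0) - Z \<in> subdiff g Y0"
  shows "bdd_below (range (\<lambda>Y. g Y - Z \<bullet> (U - Y) + \<rho> / 2 * (norm (U - Y))\<^sup>2))"
  using penalized_lower_bound[OF assms] by (intro bdd_belowI2)

text \<open>The lower bound above is uniform in \<open>Y\<close>, and the choice \<open>Y = Y0\<close> gives a matching upper bound with
  a quadratic error.\<close>

lemma envelope_has_derivative:
  fixes g :: "'b::real_inner \<Rightarrow> real"
  assumes \<rho>: "\<rho> \<ge> 0" and G: "\<rho> *\<^sub>R (U0 - Y0) - Z \<in> subdiff g Y0"
  shows "(envelope g \<rho> Z has_derivative (\<lambda>V. (\<rho> *\<^sub>R (U0 - Y0) - Z) \<bullet> V)) (at U0)"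
proof -
  let ?G = "\<rho> *\<^sub>R (U0 - Y0) - Z"
  let ?c = "g Y0 - Z \<bullet> (U0 - Y0) + \<rho> / 2 * (norm (U0 - Y0))\<^sup>2"
  have lower: "?c + ?G \<bullet> (U - U0) \<le> envelope g \<rho> Z U" for U
    unfolding envelope_def using penalized_lower_bound[OF assms] by (intro cINF_greatest) auto
  have upper: "envelope g \<rho> Z U \<le> ?c + ?G \<bullet> (U - U0) + \<rho> / 2 * (norm (U - U0))\<^sup>2" for U
  proof -
    have "envelope g \<rho> Z U \<le> g Y0 - Z \<bullet> (U - Y0) + \<rho> / 2 * (norm (U - Y0))\<^sup>2"
      unfolding envelope_def by (rule cINF_lower[OF envelope_bdd_below[OF assms]]) simp
    also have "U - Y0 = (U - U0) + (U0 - Y0)" by simp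
    also have "g Y0 - Z \<bullet> ((U - U0) + (U0 - Y0)) + \<rho> / 2 * (norm ((U - U0) + (U0 - Y0)))\<^sup>2
        = ?c + ?G \<bullet> (U - U0) + \<rho> / 2 * (norm (U - U0))\<^sup>2"
      unfolding power2_norm_eq_inner
      by (simp only: inner_add_left inner_add_right inner_diff_left[of "\<rho> *\<^sub>R (U0 - Y0)" Z]
          inner_scaleR_left inner_commute[of "U - U0" "U0 - Y0"]) (simp add: algebra_simps)
    finally show ?thesis .
  qed
  have base: "envelope g \<rho> Z U0 = ?c" using lower[of U0] upper[of U0] by simp
  show ?thesis
  proof (rule has_derivativeI_sandwich[of 1 _ _ _ _ "\<lambda>U. \<rho> / 2 * norm (U - U0)"])
    show "bounded_linear (\<lambda>V. ?G \<bullet> V)" by (rule bounded_linear_inner_right)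
    show "norm (envelope g \<rho> Z U - envelope g \<rho> Z U0 - ?G \<bullet> (U - U0)) / norm (U - U0)
        \<le> \<rho> / 2 * norm (U - U0)" if "U \<noteq> U0" for U
    proof -
      have "norm (envelope g \<rho> Z U - envelope g \<rho> Z U0 - ?G \<bullet> (U - U0)) \<le> \<rho> / 2 * (norm (U - U0))\<^sup>2"
        using lower[of U] upper[of U] base by (simp add: abs_le_iff)
      then show ?thesis using that by (simp add: divide_le_eq power2_eq_square mult.assoc)
    qed
    have "((\<lambda>U. \<rho> / 2 * norm (U - U0)) \<longlongrightarrow> \<rho> / 2 * norm (U0 - U0)) (at U0)"
      by (intro tendsto_intros)
    then show "((\<lambda>U. \<rho> / 2 * norm (U - U0)) \<longlongrightarrow> 0) (at U0)" by simp
  qed simp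
qed

section \<open>Decay of the constraint violation\<close>

text \<open>If the penalty parameter is increased only finitely often, the test \<open>e (Suc k) \<le> \<tau> * e k\<close>
  eventually always holds and \<open>e\<close> decays geometrically. Otherwise the parameter is multiplied by
  \<open>\<sigma>\<close> infinitely often, tends to infinity, and \<open>e (Suc k) \<le> C / \<rho> k\<close>.\<close>

lemma residual_tendsto_0:
  fixes e \<rho> :: "nat \<Rightarrow> real"
  assumes e: "\<And>k. e k \<ge> 0" and \<rho>0: "\<rho> 0 > 0" and \<sigma>: "\<sigma> > 1" and \<tau>: "0 < \<tau>" "\<tau> < 1"
    and upd: "\<And>k. \<rho> (Suc k) = (if e (Suc k) \<le> \<tau> * e k then \<rho> k else \<sigma> * \<rho> k)"
    and bound: "\<And>k. \<rho> k * e (Suc k) \<le> C"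
  shows "e \<longlonglongrightarrow> 0"
proof (cases "\<exists>N. \<forall>k\<ge>N. e (Suc k) \<le> \<tau> * e k")
  case True
  then obtain N where N: "\<And>k. k \<ge> N \<Longrightarrow> e (Suc k) \<le> \<tau> * e k" by blast
  have geo: "e (j + N) \<le> \<tau> ^ j * e N" for j
  proof (induction j)
    case (Suc j)
    have "e (Suc j + N) \<le> \<tau> * e (j + N)" using N[of "j + N"] by simp
    also have "\<dots> \<le> \<tau> * (\<tau> ^ j * e N)" using Suc.IH \<tau> by (intro mult_left_mono) auto
    finally show ?case by (simp add: mult.assoc)
  qed simp
  have "(\<lambda>j. \<tau> ^ j * e N) \<longlonglongrightarrow> 0 * e N"
    using \<tau> by (intro tendsto_mult tendsto_const LIMSEQ_power_zero) simp
  then have lim: "(\<lambda>j. \<tau> ^ j * e N) \<longlonglongrightarrow> 0" by simp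
  have "(\<lambda>j. e (j + N)) \<longlonglongrightarrow> 0"
  proof (rule tendsto_sandwich[OF _ _ tendsto_const lim])
    show "\<forall>\<^sub>F j in sequentially. 0 \<le> e (j + N)" using e by simp
    show "\<forall>\<^sub>F j in sequentially. e (j + N) \<le> \<tau> ^ j * e N" using geo by simp
  qed
  then show ?thesis by (rule LIMSEQ_offset)
next
  case False
  then have inf: "\<exists>k\<ge>N. \<not> e (Suc k) \<le> \<tau> * e k" for N by simp
  have pos: "\<rho> k > 0" for k using \<rho>0 \<sigma> by (induction k) (auto simp: upd)
  have "\<rho> k \<le> \<rho> (Suc k)" for k using pos[of k] \<sigma> by (auto simp: upd)
  then have mono: "mono \<rho>" by (simp add: incseq_SucI)
  have grow: "\<exists>k. \<sigma> ^ n * \<rho> 0 \<le> \<rho> k" for n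
  proof (induction n)
    case 0 show ?case by (intro exI[of _ 0]) simp
  next
    case (Suc n)
    then obtain N where N: "\<sigma> ^ n * \<rho> 0 \<le> \<rho> N" by blast
    obtain k where k: "k \<ge> N" "\<not> e (Suc k) \<le> \<tau> * e k" using inf by blast
    have "\<sigma> ^ n * \<rho> 0 \<le> \<rho> k" using N monoD[OF mono k(1)] by linarith
    then have "\<sigma> * (\<sigma> ^ n * \<rho> 0) \<le> \<sigma> * \<rho> k" using \<sigma> by (intro mult_left_mono) auto
    also have "\<dots> = \<rho> (Suc k)" using k(2) by (simp add: upd)
    finally show ?case by (auto simp: mult.assoc)
  qed
  have "filterlim \<rho> at_top sequentially"
    unfolding filterlim_at_top
  proof
    fix B
    obtain n where "B / \<rho> 0 < \<sigma> ^ n" using real_arch_pow[OF \<sigma>] by blast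
    then have "B \<le> \<sigma> ^ n * \<rho> 0" using \<rho>0 by (simp add: divide_less_eq)
    moreover obtain k where "\<sigma> ^ n * \<rho> 0 \<le> \<rho> k" using grow by blast
    ultimately have "B \<le> \<rho> k" by simp
    then show "\<forall>\<^sub>F k in sequentially. B \<le> \<rho> k"
      using monoD[OF mono] by (auto simp: eventually_sequentially intro: order_trans)
  qed
  then have lim: "(\<lambda>k. C / \<rho> k) \<longlonglongrightarrow> 0"
    by (intro tendsto_divide_0[OF tendsto_const]) (rule filterlim_at_top_imp_at_infinity)
  have le: "e (Suc k) \<le> C / \<rho> k" for k
    using bound[of k] pos[of k] by (simp add: pos_le_divide_eq mult.commute)
  have "(\<lambda>k. e (Suc k)) \<longlonglongrightarrow> 0"
  proof (rule tendsto_sandwich[OF _ _ tendsto_const lim])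
    show "\<forall>\<^sub>F k in sequentially. 0 \<le> e (Suc k)" using e by simp
    show "\<forall>\<^sub>F k in sequentially. e (Suc k) \<le> C / \<rho> k" using le by simp
  qed
  then show ?thesis by (rule LIMSEQ_imp_Suc)
qed

section \<open>Matrices\<close>

lemma abs_entry_le_entry_max_norm: "\<bar>B $ i $ j\<bar> \<le> entry_max_norm B"
  unfolding entry_max_norm_def by (rule Max_ge) (auto intro: rev_image_eqI[of "(i, j)"])

lemma entry_max_norm_le_norm: "entry_max_norm B \<le> norm B"
proof -
  have "\<bar>B $ i $ j\<bar> \<le> norm B" for i j
    using component_le_norm_cart[of "B $ i" j] Finite_Cartesian_Product.norm_nth_le[of B i] by linarith
  then show ?thesis unfolding entry_max_norm_def by (auto intro!: Max.boundedI)
qed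

lemma norm_le_entrywise:
  fixes B C :: "real ^ 'r ^ 'd"
  assumes "\<And>i j. \<bar>B $ i $ j\<bar> \<le> \<bar>C $ i $ j\<bar>"
  shows "norm B \<le> norm C"
  by (intro norm_le_componentwise_cart) (simp add: assms)

lemma bounded_matrix_box: "bounded (matrix_box Zmin Zmax)"
proof -
  let ?C = "\<chi> i j. \<bar>Zmin $ i $ j\<bar> + \<bar>Zmax $ i $ j\<bar>"
  have "norm B \<le> norm ?C" if "B \<in> matrix_box Zmin Zmax" for B
  proof (rule norm_le_entrywise)
    fix i j
    have "Zmin $ i $ j \<le> B $ i $ j" "B $ i $ j \<le> Zmax $ i $ j"
      using that by (auto simp: matrix_box_def)
    then show "\<bar>B $ i $ j\<bar> \<le> \<bar>?C $ i $ j\<bar>" by simp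
  qed
  then show ?thesis by (auto simp: bounded_iff)
qed

lemma closed_matrix_box: "closed (matrix_box Zmin Zmax)"
  unfolding matrix_box_def
  by (intro closed_Collect_all closed_Collect_conj closed_Collect_le continuous_intros)

lemma bounded_linear_matrix_mult: "bounded_linear (\<lambda>X :: real ^ 'r ^ 'n. (A :: real ^ 'n ^ 'd) ** X)"
  by (intro linear_conv_bounded_linear[THEN iffD1] linearI)
    (simp_all add: matrix_add_ldistrib matrix_scalar_ac scalar_matrix_assoc)

section \<open>Limits of approximately stationary points\<close>

lemma curve_through_eventually:
  assumes "curve_through M x v c" "open U" "x \<in> U"
  shows "\<forall>\<^sub>F t in nhds 0. c t \<in> M \<inter> U"
proof -
  obtain e where e: "e > 0" "c ` {-e<..<e} \<subseteq> M" and c: "c 0 = x" "(c has_vector_derivative v) (at 0)"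
    using assms(1) unfolding curve_through_def by blast
  have "isCont c 0" using has_vector_derivative_continuous[OF c(2)] .
  then have "(c \<longlongrightarrow> c 0) (nhds 0)" by (simp add: continuous_at tendsto_at_iff_tendsto_nhds)
  then have "\<forall>\<^sub>F t in nhds 0. c t \<in> U" using assms(2,3) c(1) by (intro topological_tendstoD) auto
  moreover have "\<forall>\<^sub>F t in nhds 0. t \<in> {-e<..<e}" using e(1) by (intro eventually_nhds_in_open) auto
  ultimately show ?thesis by eventually_elim (use e(2) in auto)
qed

text \<open>A curve in \<open>M\<close> only sees the values of \<open>f\<close> on \<open>M\<close>, so any local smooth extension computes the
  derivative.\<close>

lemma curve_through_derivative:
  fixes f :: "'a::euclidean_space \<Rightarrow> real"
  assumes c: "curve_through M x v c" and U: "open U" "x \<in> U"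
    and F: "smooth_on U F" "\<And>y. y \<in> M \<inter> U \<Longrightarrow> F y = f y"
  shows "((\<lambda>t. f (c t)) has_real_derivative frechet_derivative F (at x) v) (at 0)"
proof -
  have c0: "c 0 = x" and dc: "(c has_derivative (\<lambda>t. t *\<^sub>R v)) (at 0)"
    using c unfolding curve_through_def has_vector_derivative_def by auto
  have dF: "(F has_derivative frechet_derivative F (at x)) (at x)"
    using F(1) U(2) by (rule smooth_on_has_derivative)
  have "((\<lambda>t. F (c t)) has_derivative (\<lambda>t. frechet_derivative F (at x) (t *\<^sub>R v))) (at 0)"
    using has_derivative_compose[OF dc, of F "frechet_derivative F (at x)"] dF c0 by simp
  then have "((\<lambda>t. F (c t)) has_real_derivative frechet_derivative F (at x) v) (at 0)"
    using has_derivative_linear[OF dF]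
    by (simp add: has_field_derivative_def linear_cmul mult.commute[of _ "frechet_derivative F (at x) v"])
  moreover have ev: "\<forall>\<^sub>F t in nhds 0. F (c t) = f (c t)"
    using curve_through_eventually[OF c U] by eventually_elim (rule F(2))
  ultimately show ?thesis using DERIV_cong_ev[OF refl ev refl] by simp
qed

text \<open>Tangent spaces vary with the base point, so a tangent vector at the limit has to be approximated by
  tangent vectors at the sequence before the approximate stationarity condition can be passed to the
  limit. A chart at the limit does this without any orthogonal projections.\<close>

lemma stationarity_limit:
  fixes M :: "'a::euclidean_space set" and A :: "'a \<Rightarrow> 'b::euclidean_space"
  assumes M: "embedded_submanifold M" "x' \<in> M" "\<And>n. x n \<in> M"
    and U: "open U" "x' \<in> U" and F: "smooth_on U F"
    and A: "bounded_linear A"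
    and lim: "x \<longlonglongrightarrow> x'" "z \<longlonglongrightarrow> z'" "\<xi> \<longlonglongrightarrow> 0"
    and stat: "\<And>n v. x n \<in> U \<Longrightarrow> v \<in> tangent_space M (x n) \<Longrightarrow>
      \<xi> n \<bullet> v = frechet_derivative F (at (x n)) v - z n \<bullet> A v"
    and v: "v \<in> tangent_space M x'"
  shows "frechet_derivative F (at x') v = z' \<bullet> A v"
proof -
  obtain V \<Phi> \<Psi> S where chart: "slice_chart M x' V \<Phi> \<Psi> S"
    using M unfolding embedded_submanifold_def by blast
  note c = slice_chartD[OF chart]
  obtain s where s: "s \<in> S" "v = frechet_derivative \<Psi> (at (\<Phi> x')) s"
    using v unfolding tangent_space_slice_chart[OF chart M(2)] by blast
  \<comment> \<open>The vector \<open>s\<close> that represents \<open>v\<close> in the chart, read at the points \<open>x n\<close>.\<close>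
  define w where "w n = frechet_derivative \<Psi> (at (\<Phi> (x n))) s" for n
  have "isCont \<Phi> x'" using slice_chart_derivatives(1)[OF chart] by (rule has_derivative_continuous)
  then have "(\<lambda>n. \<Phi> (x n)) \<longlonglongrightarrow> \<Phi> x'" using lim(1) by (rule isCont_tendsto_compose)
  then have w: "w \<longlonglongrightarrow> v"
    unfolding w_def s(2) using c(2) by (intro smooth_on_derivative_tendsto[OF c(8,3)]) auto
  have "\<forall>\<^sub>F n in sequentially. x n \<in> U \<inter> V"
    using lim(1) U c(1,2) by (intro topological_tendstoD) auto
  then have ev: "\<forall>\<^sub>F n in sequentially. \<xi> n \<bullet> w n = frechet_derivative F (at (x n)) (w n) - z n \<bullet> A (w n)"
  proof eventually_elim
    case (elim n)
    then have "slice_chart M (x n) V \<Phi> \<Psi> S" using slice_chart_move[OF chart] by blast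
    then have "w n \<in> tangent_space M (x n)"
      using tangent_space_slice_chart[OF _ M(3)] s(1) by (auto simp: w_def)
    with elim show ?case by (intro stat) auto
  qed
  have lim_F: "(\<lambda>n. frechet_derivative F (at (x n)) (w n) - z n \<bullet> A (w n))
      \<longlonglongrightarrow> frechet_derivative F (at x') v - z' \<bullet> A v"
    by (intro tendsto_intros smooth_on_derivative_tendsto[OF F U] bounded_linear.tendsto[OF A] lim w)
  have "(\<lambda>n. \<xi> n \<bullet> w n) \<longlonglongrightarrow> 0 \<bullet> v" by (intro tendsto_intros lim w)
  then have "0 \<bullet> v = frechet_derivative F (at x') v - z' \<bullet> A v"
    using tendsto_cong[OF ev, THEN iffD2, OF lim_F] by (rule LIMSEQ_unique)
  then show ?thesis by simp
qed

section \<open>Clarke subgradients of smooth plus convex functions\<close>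

text \<open>Restricting the pair \<open>(y, t)\<close> to \<open>y = x\<close> can only decrease the upper limit.\<close>

lemma Limsup_pair_ge:
  fixes h :: "real \<Rightarrow> real" and q :: "'a::topological_space \<Rightarrow> real \<Rightarrow> ereal"
  assumes "x \<in> N" and h: "(h \<longlongrightarrow> l) (at_right 0)"
    and le: "\<forall>\<^sub>F t in at_right 0. ereal (h t) \<le> q x t"
  shows "ereal l \<le> Limsup (inf (nhds x) (principal N) \<times>\<^sub>F at_right 0) (\<lambda>(y, t). q y t)"
proof (rule Limsup_greatest)
  fix P :: "'a \<times> real \<Rightarrow> bool"
  assume "eventually P (inf (nhds x) (principal N) \<times>\<^sub>F at_right 0)"
  then obtain P1 P2 where P1: "eventually P1 (inf (nhds x) (principal N))"
    and P2: "eventually P2 (at_right (0::real))" and P: "\<And>y t. P1 y \<Longrightarrow> P2 t \<Longrightarrow> P (y, t)"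
    unfolding eventually_prod_filter by blast
  have "P1 x"
    using eventually_nhds_x_imp_x[OF P1[unfolded eventually_inf_principal]] assms(1) by blast
  have "\<forall>\<^sub>F t in at_right 0. ereal (h t) \<le> (SUP p\<in>Collect P. case p of (y, t) \<Rightarrow> q y t)"
    using le P2
  proof eventually_elim
    case (elim t)
    have "(x, t) \<in> Collect P" using P[OF \<open>P1 x\<close> elim(2)] by simp
    from SUP_upper[OF this, of "\<lambda>(y, t). q y t"]
    have "q x t \<le> (SUP p\<in>Collect P. case p of (y, t) \<Rightarrow> q y t)" by simp
    with elim(1) show ?case by (rule order_trans)
  qed
  moreover have "((\<lambda>t. ereal (h t)) \<longlongrightarrow> ereal l) (at_right 0)" using h by simp
  ultimately show "ereal l \<le> (SUP p\<in>Collect P. case p of (y, t) \<Rightarrow> q y t)"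
    by (intro tendsto_upperbound) auto
qed

text \<open>With the base point fixed, the chart turns the difference quotient into one along a curve with
  velocity \<open>v\<close>. There \<open>f\<close> has a derivative, and the subgradient inequality bounds the
  \<open>g\<close>-part from below by a linear function.\<close>

lemma rclarke_subdiff_sum:
  fixes M :: "'a::euclidean_space set" and g :: "'b::euclidean_space \<Rightarrow> real" and f :: "'a \<Rightarrow> real"
  assumes W: "W \<in> M \<times> UNIV" and U: "open U" "fst W \<in> U"
    and F: "smooth_on U F" "\<And>y. y \<in> M \<inter> U \<Longrightarrow> F y = f y"
    and \<zeta>: "\<zeta> \<in> subdiff g (snd W)"
    and \<xi>: "\<xi> \<in> tangent_space (M \<times> UNIV) W"
      "\<And>v. v \<in> tangent_space (M \<times> UNIV) W \<Longrightarrow>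
        \<xi> \<bullet> v = frechet_derivative F (at (fst W)) (fst v) + \<zeta> \<bullet> snd v"
  shows "\<xi> \<in> rclarke_subdiff (M \<times> UNIV) (\<lambda>W. f (fst W) + g (snd W)) W"
  unfolding rclarke_subdiff_def
proof (intro CollectI conjI allI impI ballI)
  fix V \<Phi> \<Psi> S v
  assume chart: "slice_chart (M \<times> (UNIV :: 'b set)) W V \<Phi> \<Psi> S" and v: "v \<in> tangent_space (M \<times> UNIV) W"
  let ?w = "frechet_derivative \<Phi> (at W) v"
  define c where "c t = \<Psi> (\<Phi> W + t *\<^sub>R ?w)" for t
  have curve: "curve_through (M \<times> UNIV) W v c"
    using slice_chart_curve[OF chart W slice_chart_tangent_in_slice[OF chart v]]
    unfolding slice_chart_derivative_inverse[OF chart] c_def .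
  then have c0: "c 0 = W" and dc: "(c has_vector_derivative v) (at 0)"
    by (auto simp: curve_through_def)
  \<comment> \<open>\<open>g\<close> is replaced by its affine minorant at \<open>snd W\<close>, up to a constant.\<close>
  define p where "p t = f (fst (c t)) + \<zeta> \<bullet> snd (c t)" for t
  have "((\<lambda>t. \<zeta> \<bullet> snd (c t)) has_vector_derivative \<zeta> \<bullet> snd v) (at 0)"
    by (intro bounded_linear.has_vector_derivative[OF bounded_linear_inner_right]
        bounded_linear.has_vector_derivative[OF bounded_linear_snd] dc)
  then have "(p has_real_derivative \<xi> \<bullet> v) (at 0)"
    unfolding p_def \<xi>(2)[OF v]
    by (intro DERIV_add curve_through_derivative[OF curve_through_fst[OF curve] U F])
      (simp_all add: has_real_derivative_iff_has_vector_derivative)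
  then have "((\<lambda>t. (p t - p 0) / t) \<longlongrightarrow> \<xi> \<bullet> v) (at_right 0)"
    by (auto simp: has_field_derivative_iff intro: filterlim_mono at_le)
  moreover have "\<forall>\<^sub>F t in at_right 0. ereal ((p t - p 0) / t)
      \<le> ereal ((f (fst (c t)) + g (snd (c t)) - (f (fst W) + g (snd W))) / t)"
    using eventually_at_right_less[of "0::real"]
  proof eventually_elim
    case (elim t)
    have "g (snd W) + \<zeta> \<bullet> (snd (c t) - snd W) \<le> g (snd (c t))" using \<zeta> by (simp add: subdiff_def)
    then have "p t - p 0 \<le> f (fst (c t)) + g (snd (c t)) - (f (fst W) + g (snd W))"
      by (simp add: p_def c0 inner_diff_right)
    then show ?case using elim by (simp add: divide_right_mono)
  qed
  ultimately show "ereal (\<xi> \<bullet> v) \<le> rclarke_dir (M \<times> UNIV) (\<lambda>W. f (fst W) + g (snd W)) W \<Phi> \<Psi> v"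
    unfolding rclarke_dir_def c_def
    by (rule Limsup_pair_ge[OF W, where q = "\<lambda>y t. ereal ((f (fst (\<Psi> (\<Phi> y + t *\<^sub>R ?w)))
      + g (snd (\<Psi> (\<Phi> y + t *\<^sub>R ?w))) - (f (fst y) + g (snd y))) / t)"])
qed (rule \<xi>(1))

section \<open>The reduced Lagrangian and the constraints\<close>

lemma reduced_lagrangian_eq:
  fixes g :: "real ^ 'r ^ 'd \<Rightarrow> real"
  assumes "\<rho> \<ge> 0" and "\<rho> *\<^sub>R (U0 - Y0) - Z \<in> subdiff g Y0"
  shows "reduced_lagrangian f g A \<rho> Z X = f X + envelope g \<rho> Z (A ** X)"
proof -
  let ?p = "\<lambda>Y. g Y - Z \<bullet> (A ** X - Y) + \<rho> / 2 * (norm (A ** X - Y))\<^sup>2"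
  have bdd: "bdd_below (range ?p)" by (rule envelope_bdd_below[OF assms])
  have "(INF Y. f X + ?p Y) = f X + (INF Y. ?p Y)"
  proof (rule antisym)
    obtain m where "\<And>Y. m \<le> ?p Y" using bdd unfolding bdd_below_def by blast
    then have "bdd_below (range (\<lambda>Y. f X + ?p Y))"
      by (intro bdd_belowI2[of _ "f X + m"] add_left_mono)
    then have "(INF Y. f X + ?p Y) - f X \<le> ?p Y" for Y
      using cINF_lower[of "\<lambda>Y. f X + ?p Y" UNIV Y] by simp
    then have "(INF Y. f X + ?p Y) - f X \<le> (INF Y. ?p Y)" by (intro cINF_greatest) auto
    then show "(INF Y. f X + ?p Y) \<le> f X + (INF Y. ?p Y)" by simp
    show "f X + (INF Y. ?p Y) \<le> (INF Y. f X + ?p Y)"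
      using cINF_lower[OF bdd] by (intro cINF_greatest) auto
  qed
  then show ?thesis
    by (simp add: reduced_lagrangian_def aug_lagrangian_def envelope_def algebra_simps)
qed

lemma rgrad_reduced_lagrangian:
  fixes M :: "(real ^ 'r ^ 'n) set" and g :: "real ^ 'r ^ 'd \<Rightarrow> real"
  assumes M: "embedded_submanifold M" "X \<in> M"
    and U: "open U" "X \<in> U" and F: "smooth_on U F" "\<And>y. y \<in> M \<inter> U \<Longrightarrow> F y = f y"
    and \<rho>: "\<rho> \<ge> 0" and G: "\<rho> *\<^sub>R (A ** X - Y) - Z \<in> subdiff g Y"
    and v: "v \<in> tangent_space M X"
  shows "rgrad M (reduced_lagrangian f g A \<rho> Z) X \<bullet> v
    = frechet_derivative F (at X) v + (\<rho> *\<^sub>R (A ** X - Y) - Z) \<bullet> (A ** v)"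
proof (rule rgrad_characterization(2)[OF subspace_tangent_space[OF M] _ _ v])
  let ?G = "\<rho> *\<^sub>R (A ** X - Y) - Z"
  have lF: "linear (frechet_derivative F (at X))"
    using smooth_on_has_derivative[OF F(1) U(2)] by (rule has_derivative_linear)
  have lG: "bounded_linear (\<lambda>v. ?G \<bullet> (A ** v))"
    by (rule bounded_linear_compose[OF bounded_linear_inner_right bounded_linear_matrix_mult])
  show "linear (\<lambda>v. frechet_derivative F (at X) v + ?G \<bullet> (A ** v))"
    by (rule linear_compose_add[OF lF bounded_linear.linear[OF lG]])
  fix v c assume c: "curve_through M X v c"
  then have c0: "c 0 = X" and dc: "(c has_vector_derivative v) (at 0)"
    by (auto simp: curve_through_def)
  have dA: "((\<lambda>t. A ** c t) has_derivative (\<lambda>t. t *\<^sub>R (A ** v))) (at 0)"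
    using bounded_linear.has_vector_derivative[OF bounded_linear_matrix_mult dc]
    by (simp only: has_vector_derivative_def)
  have "((\<lambda>t. envelope g \<rho> Z (A ** c t)) has_derivative (\<lambda>t. ?G \<bullet> (t *\<^sub>R (A ** v)))) (at 0)"
    using has_derivative_compose[OF dA, of "envelope g \<rho> Z" "\<lambda>V. ?G \<bullet> V"]
      envelope_has_derivative[OF \<rho> G] c0 by simp
  then have "((\<lambda>t. envelope g \<rho> Z (A ** c t)) has_real_derivative ?G \<bullet> (A ** v)) (at 0)"
    by (simp add: has_field_derivative_def mult.commute[of _ "?G \<bullet> (A ** v)"])
  with curve_through_derivative[OF c U F]
  show "((\<lambda>t. reduced_lagrangian f g A \<rho> Z (c t)) has_real_derivative
      frechet_derivative F (at X) v + ?G \<bullet> (A ** v)) (at 0)"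
    unfolding reduced_lagrangian_eq[OF \<rho> G] by (rule DERIV_add)
qed

lemma subspace_tangent_space_prod_manifold:
  assumes "embedded_submanifold M" "W \<in> prod_manifold M"
  shows "subspace (tangent_space (prod_manifold M) W)"
proof -
  have "subspace (tangent_space M (fst W) \<times> UNIV)"
    using assms by (intro subspace_Times subspace_tangent_space subspace_UNIV)
      (auto simp: prod_manifold_def)
  then show ?thesis
    using tangent_space_times_UNIV[of M "fst W" "snd W"] by (simp add: prod_manifold_def)
qed

text \<open>Each constraint is linear on the ambient space, so it is its own derivative.\<close>

lemma constr_grad_inner:
  fixes M :: "(real ^ 'r ^ 'n) set" and A :: "real ^ 'n ^ 'd"
  assumes "embedded_submanifold M" "W \<in> prod_manifold M"
  shows "constr_grad M A W i j \<in> tangent_space (prod_manifold M) W"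
    and "v \<in> tangent_space (prod_manifold M) W \<Longrightarrow> constr_grad M A W i j \<bullet> v = constr A v $ i $ j"
proof -
  have bl: "bounded_linear (\<lambda>v. constr A v $ i $ j)"
    unfolding constr_def
    by (intro bounded_linear_compose[OF bounded_linear_vec_nth] bounded_linear_sub
        bounded_linear_compose[OF bounded_linear_matrix_mult] bounded_linear_fst bounded_linear_snd)
  have D: "((\<lambda>t. constr A (c t) $ i $ j) has_real_derivative constr A v $ i $ j) (at 0)"
    if "curve_through (prod_manifold M) W v c" for v and c :: "real \<Rightarrow> (real ^ 'r ^ 'n) \<times> (real ^ 'r ^ 'd)"
    using that bounded_linear.has_vector_derivative[OF bl]
    by (auto simp: curve_through_def has_real_derivative_iff_has_vector_derivative)
  note sub = subspace_tangent_space_prod_manifold[OF assms]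
  show "constr_grad M A W i j \<in> tangent_space (prod_manifold M) W"
    unfolding constr_grad_def
    by (rule rgrad_characterization(1)[OF sub bounded_linear.linear[OF bl]]) (rule D)
  show "constr_grad M A W i j \<bullet> v = constr A v $ i $ j" if "v \<in> tangent_space (prod_manifold M) W"
    unfolding constr_grad_def
    by (rule rgrad_characterization(2)[OF sub bounded_linear.linear[OF bl] _ that]) (rule D)
qed

text \<open>On the tangent space, the combination of constraint gradients with coefficients \<open>\<zeta>\<close> represents
  \<open>v \<mapsto> \<zeta> \<bullet> constr A v\<close>. By stationarity its negative is the derivative of \<open>f\<close> in the first component
  plus \<open>\<zeta>\<close> in the second, an element of the Clarke subdifferential of the objective.\<close>

lemma KKT_pointI:
  fixes M :: "(real ^ 'r ^ 'n) set" and g :: "real ^ 'r ^ 'd \<Rightarrow> real" and A :: "real ^ 'n ^ 'd"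
  assumes M: "embedded_submanifold M" and W: "W \<in> prod_manifold M" "constr A W = 0"
    and U: "open U" "fst W \<in> U" and F: "smooth_on U F" "\<And>y. y \<in> M \<inter> U \<Longrightarrow> F y = f y"
    and \<zeta>: "\<zeta> \<in> subdiff g (snd W)"
    and stat: "\<And>v. v \<in> tangent_space M (fst W) \<Longrightarrow>
      frechet_derivative F (at (fst W)) v + \<zeta> \<bullet> (A ** v) = 0"
  shows "KKT_point M f g A W"
proof -
  let ?N = "prod_manifold M :: ((real ^ 'r ^ 'n) \<times> (real ^ 'r ^ 'd)) set"
  \<comment> \<open>With \<open>\<zeta>\<close> as multiplier the KKT condition asks for the Clarke subgradient \<open>- \<nu>\<close>.\<close>
  define \<nu> where "\<nu> = (\<Sum>i\<in>UNIV. \<Sum>j\<in>UNIV. \<zeta> $ i $ j *\<^sub>R constr_grad M A W i j)"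
  have sub: "subspace (tangent_space ?N W)"
    by (rule subspace_tangent_space_prod_manifold[OF M W(1)])
  have \<nu>T: "\<nu> \<in> tangent_space ?N W"
    unfolding \<nu>_def
    by (intro subspace_sum[OF sub] subspace_scale[OF sub] constr_grad_inner(1)[OF M W(1)])
  have \<nu>v: "\<nu> \<bullet> v = \<zeta> \<bullet> constr A v" if "v \<in> tangent_space ?N W" for v
  proof -
    have "\<nu> \<bullet> v = (\<Sum>i\<in>UNIV. \<Sum>j\<in>UNIV. \<zeta> $ i $ j * (constr_grad M A W i j \<bullet> v))"
      by (simp add: \<nu>_def inner_sum_left)
    also have "\<dots> = (\<Sum>i\<in>UNIV. \<Sum>j\<in>UNIV. \<zeta> $ i $ j * constr A v $ i $ j)"
      by (simp only: constr_grad_inner(2)[OF M W(1) that])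
    also have "\<dots> = \<zeta> \<bullet> constr A v" by (simp add: inner_vec_def)
    finally show ?thesis .
  qed
  have "- \<nu> \<in> rclarke_subdiff (M \<times> UNIV) (\<lambda>W. f (fst W) + g (snd W)) W"
  proof (rule rclarke_subdiff_sum[OF _ U F \<zeta>])
    show "W \<in> M \<times> UNIV" using W(1) by (simp add: prod_manifold_def)
    show "- \<nu> \<in> tangent_space (M \<times> UNIV) W"
      using subspace_neg[OF sub \<nu>T] by (simp add: prod_manifold_def)
    show "- \<nu> \<bullet> v = frechet_derivative F (at (fst W)) (fst v) + \<zeta> \<bullet> snd v"
      if "v \<in> tangent_space (M \<times> UNIV) W" for v
    proof -
      have "fst v \<in> tangent_space M (fst W)"
        using that tangent_space_times_UNIV[of M "fst W" "snd W"] by (auto simp: mem_Times_iff)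
      from stat[OF this] \<nu>v[of v] that show ?thesis
        by (simp add: prod_manifold_def constr_def inner_diff_right)
    qed
  qed
  then have "- \<nu> \<in> rclarke_subdiff ?N (objective f g) W"
    by (simp add: prod_manifold_def objective_def[abs_def])
  then have "\<exists>\<xi>. 0 = \<xi> + \<nu> \<and> \<xi> \<in> rclarke_subdiff ?N (objective f g) W"
    by (intro exI[of _ "- \<nu>"]) simp
  then show ?thesis
    unfolding KKT_point_def \<nu>_def using W by blast
qed

section \<open>Convergence of the method\<close>

lemma MIALM_D:
  assumes "MIALM M g A Zmin Zmax \<sigma> \<tau> X Y Z Zbar \<rho>"
  shows "X k \<in> M"
    and "Y (Suc k) = prox (1 / \<rho> k) g (A ** X (Suc k) - (1 / \<rho> k) *\<^sub>R Zbar k)"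
    and "Z (Suc k) = Zbar k - \<rho> k *\<^sub>R (A ** X (Suc k) - Y (Suc k))"
    and "Zbar (Suc k) = closest_point (matrix_box Zmin Zmax) (Z (Suc k))"
    and "\<rho> (Suc k) = (if entry_max_norm (A ** X (Suc k) - Y (Suc k))
        \<le> \<tau> * entry_max_norm (A ** X k - Y k) then \<rho> k else \<sigma> * \<rho> k)"
  using assms unfolding MIALM_def by (cases k; blast)+

lemma MIALM_penalty_ge_1:
  assumes alg: "MIALM M g A Zmin Zmax \<sigma> \<tau> X Y Z Zbar \<rho>" and "\<rho> 0 > 1" "\<sigma> > 1"
  shows "\<rho> k > 1"
proof (induction k)
  case (Suc k)
  have "1 * 1 < \<sigma> * \<rho> k" using Suc assms(3) by (intro mult_strict_mono) auto
  with Suc show ?case unfolding MIALM_D(5)[OF alg] by simp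
qed (rule assms(2))

text \<open>The multiplier update is exactly the optimality condition of the proximal step.\<close>

lemma MIALM_multiplier_subgradient:
  assumes alg: "MIALM M g A Zmin Zmax \<sigma> \<tau> X Y Z Zbar \<rho>" and g: "convex_on UNIV g" and \<rho>: "\<rho> k > 0"
  shows "- Z (Suc k) \<in> subdiff g (Y (Suc k))"
proof -
  have "(1 / (1 / \<rho> k)) *\<^sub>R (A ** X (Suc k) - (1 / \<rho> k) *\<^sub>R Zbar k - Y (Suc k)) \<in> subdiff g (Y (Suc k))"
    unfolding MIALM_D(2)[OF alg] using \<rho> by (intro prox_subgradient[OF g]) simp
  also have "(1 / (1 / \<rho> k)) *\<^sub>R (A ** X (Suc k) - (1 / \<rho> k) *\<^sub>R Zbar k - Y (Suc k)) = - Z (Suc k)"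
    unfolding MIALM_D(3)[OF alg] using \<rho> by (simp add: scaleR_diff_right)
  finally show ?thesis .
qed

lemma MIALM_rgrad:
  assumes alg: "MIALM M g A Zmin Zmax \<sigma> \<tau> X Y Z Zbar \<rho>" and g: "convex_on UNIV g"
    and M: "embedded_submanifold M" and \<rho>: "\<rho> k > 0"
    and U: "open U" "X (Suc k) \<in> U" and F: "smooth_on U F" "\<And>y. y \<in> M \<inter> U \<Longrightarrow> F y = f y"
    and v: "v \<in> tangent_space M (X (Suc k))"
  shows "rgrad M (reduced_lagrangian f g A (\<rho> k) (Zbar k)) (X (Suc k)) \<bullet> v
    = frechet_derivative F (at (X (Suc k))) v - Z (Suc k) \<bullet> (A ** v)"
proof -
  have eq: "\<rho> k *\<^sub>R (A ** X (Suc k) - Y (Suc k)) - Zbar k = - Z (Suc k)"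
    unfolding MIALM_D(3)[OF alg] by simp
  have G: "\<rho> k *\<^sub>R (A ** X (Suc k) - Y (Suc k)) - Zbar k \<in> subdiff g (Y (Suc k))"
    unfolding eq by (rule MIALM_multiplier_subgradient[OF alg g \<rho>])
  show ?thesis
    using rgrad_reduced_lagrangian[OF M MIALM_D(1)[OF alg] U F less_imp_le[OF \<rho>] G v]
    unfolding eq by (simp only: inner_minus_left add_uminus_conv_diff)
qed

text \<open>The first multiplier estimate \<open>Zbar 0\<close> is arbitrary; all later ones lie in the box.\<close>

lemma MIALM_bounded_residual:
  assumes alg: "MIALM M g A Zmin Zmax \<sigma> \<tau> X Y Z Zbar \<rho>" and g: "convex_on UNIV g"
    and bnd: "bounded (\<Union>V. subdiff g V)" and box: "\<And>i j. Zmin $ i $ j < Zmax $ i $ j"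
    and \<rho>: "\<And>k. \<rho> k > 0"
  shows "\<exists>C. \<forall>k. norm (Z (Suc k)) \<le> C \<and> \<rho> k * norm (A ** X (Suc k) - Y (Suc k)) \<le> C"
proof -
  obtain B where B: "\<And>z. z \<in> (\<Union>V. subdiff g V) \<Longrightarrow> norm z \<le> B" using bnd by (auto simp: bounded_iff)
  have ZB: "norm (Z (Suc k)) \<le> B" for k
    using B[of "- Z (Suc k)"] MIALM_multiplier_subgradient[OF alg g \<rho>] by auto
  obtain D where D: "\<And>z. z \<in> matrix_box Zmin Zmax \<Longrightarrow> norm z \<le> D"
    using bounded_matrix_box[of Zmin Zmax] unfolding bounded_iff by blast
  have "Zmin \<in> matrix_box Zmin Zmax" using box by (auto simp: matrix_box_def intro: less_imp_le)
  then have "Zbar (Suc k) \<in> matrix_box Zmin Zmax" for k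
    unfolding MIALM_D(4)[OF alg] by (intro closest_point_in_set closed_matrix_box) auto
  then have Zb: "norm (Zbar k) \<le> max D (norm (Zbar 0))" for k
    using D by (cases k) (auto intro: le_max_iff_disj[THEN iffD2])
  have "\<rho> k * norm (A ** X (Suc k) - Y (Suc k)) \<le> max D (norm (Zbar 0)) + B" for k
  proof -
    have "\<rho> k * norm (A ** X (Suc k) - Y (Suc k)) = norm (\<rho> k *\<^sub>R (A ** X (Suc k) - Y (Suc k)))"
      using \<rho>[of k] by simp
    also have "\<rho> k *\<^sub>R (A ** X (Suc k) - Y (Suc k)) = Zbar k - Z (Suc k)"
      unfolding MIALM_D(3)[OF alg] by simp
    also have "norm \<dots> \<le> norm (Zbar k) + norm (Z (Suc k))" by (rule norm_triangle_ineq4)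
    also have "\<dots> \<le> max D (norm (Zbar 0)) + B" using Zb ZB by (rule add_mono)
    finally show ?thesis .
  qed
  moreover have "norm (Z (Suc k)) \<le> max D (norm (Zbar 0)) + B" for k
  proof -
    have "0 \<le> max D (norm (Zbar 0))" by (simp add: le_max_iff_disj)
    with ZB[of k] show ?thesis by linarith
  qed
  ultimately show ?thesis by (intro exI[of _ "max D (norm (Zbar 0)) + B"]) simp
qed

lemma MIALM_feasible_limit:
  assumes alg: "MIALM M g A Zmin Zmax \<sigma> \<tau> X Y Z Zbar \<rho>" and g: "convex_on UNIV g"
    and bnd: "bounded (\<Union>V. subdiff g V)" and box: "\<And>i j. Zmin $ i $ j < Zmax $ i $ j"
    and par: "\<rho> 0 > 1" "\<sigma> > 1" "0 < \<tau>" "\<tau> < 1"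
  shows "(\<lambda>k. A ** X k - Y k) \<longlonglongrightarrow> 0"
proof -
  let ?e = "\<lambda>k. entry_max_norm (A ** X k - Y k)"
  have \<rho>: "\<rho> k > 0" for k using MIALM_penalty_ge_1[OF alg par(1,2), of k] by simp
  obtain C where C: "\<forall>k. norm (Z (Suc k)) \<le> C \<and> \<rho> k * norm (A ** X (Suc k) - Y (Suc k)) \<le> C"
    using MIALM_bounded_residual[OF alg g bnd box \<rho>] ..
  have nonneg: "?e k \<ge> 0" for k
    using abs_entry_le_entry_max_norm[of "A ** X k - Y k" undefined undefined] by linarith
  have "\<rho> k * ?e (Suc k) \<le> C" for k
    using mult_left_mono[OF entry_max_norm_le_norm less_imp_le[OF \<rho>[of k]]] C
    by (meson order_trans)
  then have lim: "?e \<longlonglongrightarrow> 0"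
    using nonneg par \<rho> MIALM_D(5)[OF alg] by (intro residual_tendsto_0[of ?e \<rho> \<sigma> \<tau> C])
  show ?thesis
  proof (intro vec_tendstoI)
    fix i j
    have "(\<lambda>k. (A ** X k - Y k) $ i $ j) \<longlonglongrightarrow> 0"
      by (rule Lim_null_comparison[OF always_eventually lim]) (simp only: real_norm_def abs_entry_le_entry_max_norm simp_thms)
    then show "(\<lambda>k. (A ** X k - Y k) $ i $ j) \<longlonglongrightarrow> 0 $ i $ j" by simp
  qed
qed

theorem theorem5p1:
  fixes M :: "(real ^ 'r ^ 'n) set"
    and f :: "real ^ 'r ^ 'n \<Rightarrow> real"
    and g :: "real ^ 'r ^ 'd \<Rightarrow> real"
    and A :: "real ^ 'n ^ 'd"
    and Zmin Zmax :: "real ^ 'r ^ 'd"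
    and \<sigma> \<tau> :: real
    and \<epsilon> \<rho> :: "nat \<Rightarrow> real"
    and X :: "nat \<Rightarrow> real ^ 'r ^ 'n"
    and Y Z Zbar :: "nat \<Rightarrow> real ^ 'r ^ 'd"
  assumes "compact M" and "embedded_submanifold M"
    and "smooth_on_manifold M f"
    and "convex_on UNIV g"
    and "bounded (\<Union>V. subdiff g V)"
    and "\<And>i j. Zmin $ i $ j < Zmax $ i $ j"
    and "\<rho> 0 > 1" and "\<sigma> > 1" and "0 < \<tau>" and "\<tau> < 1"
    and "\<And>k. \<epsilon> k > 0" and "decseq \<epsilon>" and "\<epsilon> \<longlonglongrightarrow> 0"
    and "MIALM M g A Zmin Zmax \<sigma> \<tau> X Y Z Zbar \<rho>"
    and "\<And>k. norm (rgrad M (reduced_lagrangian f g A (\<rho> k) (Zbar k)) (X (Suc k))) \<le> \<epsilon> k"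
  shows "(\<exists>W. cluster_point (\<lambda>k. (X k, Y k)) W) \<and>
         (\<forall>W. cluster_point (\<lambda>k. (X k, Y k)) W \<longrightarrow> LICQ M A W \<longrightarrow> KKT_point M f g A W)"
proof (intro conjI allI impI)
  note M = assms(2) and g = assms(4) and alg = assms(14)
  note feas = MIALM_feasible_limit[OF alg g assms(5-10)]
  have \<rho>: "\<rho> k > 0" for k using MIALM_penalty_ge_1[OF alg assms(7,8), of k] by simp
  obtain C where C: "\<forall>k. norm (Z (Suc k)) \<le> C \<and> \<rho> k * norm (A ** X (Suc k) - Y (Suc k)) \<le> C"
    using MIALM_bounded_residual[OF alg g assms(5,6) \<rho>] ..
  have A_lim: "(\<lambda>n. A ** s n) \<longlonglongrightarrow> A ** x" if "s \<longlonglongrightarrow> x" for s x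
    by (rule bounded_linear.tendsto[OF bounded_linear_matrix_mult that])
  show "\<exists>W. cluster_point (\<lambda>k. (X k, Y k)) W"
  proof -
    obtain x q where q: "strict_mono q" and x: "(X \<circ> q) \<longlonglongrightarrow> x"
      using assms(1) MIALM_D(1)[OF alg] unfolding compact_def by metis
    have "(\<lambda>n. A ** X (q n) - (A ** X (q n) - Y (q n))) \<longlonglongrightarrow> A ** x - 0"
      using A_lim[OF x] LIMSEQ_subseq_LIMSEQ[OF feas q] by (intro tendsto_diff) (simp_all add: o_def)
    then have "((\<lambda>k. (X k, Y k)) \<circ> q) \<longlonglongrightarrow> (x, A ** x)"
      using x by (auto simp: o_def intro: tendsto_Pair)
    with q show ?thesis unfolding cluster_point_def by blast
  qed
  fix W assume "cluster_point (\<lambda>k. (X k, Y k)) W"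
  then obtain q where q: "strict_mono q" and W: "((\<lambda>k. (X k, Y k)) \<circ> q) \<longlonglongrightarrow> W"
    unfolding cluster_point_def by blast
  have qX: "(\<lambda>n. X (q n)) \<longlonglongrightarrow> fst W" and qY: "(\<lambda>n. Y (q n)) \<longlonglongrightarrow> snd W"
    using tendsto_fst[OF W] tendsto_snd[OF W] by (simp_all add: o_def)
  have "fst W \<in> M"
    using closed_sequentially[OF compact_imp_closed[OF assms(1)] _ qX] MIALM_D(1)[OF alg] by blast
  have "(\<lambda>n. A ** X (q n) - Y (q n)) \<longlonglongrightarrow> A ** fst W - snd W"
    by (intro tendsto_diff A_lim qX qY)
  with LIMSEQ_subseq_LIMSEQ[OF feas q] have feasible: "constr A W = 0"
    unfolding constr_def by (auto simp: o_def dest: LIMSEQ_unique)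
  \<comment> \<open>The multiplier relations hold for successor indices only, so the subsequence is shifted past
    a possible index 0.\<close>
  define p where "p n = q (Suc n) - 1" for n
  have Suc_p: "Suc (p n) = q (Suc n)" for n
    using strict_mono_imp_increasing[OF q, of "Suc n"] by (simp add: p_def)
  have p: "strict_mono p"
    using q Suc_p by (metis Suc_less_eq strict_mono_Suc_iff)
  have "bounded (range (\<lambda>n. Z (Suc (p n))))" using C by (auto simp: bounded_iff)
  then obtain z r where r: "strict_mono r" and z: "(\<lambda>n. Z (Suc (p (r n)))) \<longlonglongrightarrow> z"
    using bounded_imp_convergent_subsequence[of "\<lambda>n. Z (Suc (p n))"] by (auto simp: o_def)
  have sub: "strict_mono (\<lambda>n. Suc (r n))" using r by (simp add: strict_mono_def)
  have xX: "(\<lambda>n. X (Suc (p (r n)))) \<longlonglongrightarrow> fst W" and yY: "(\<lambda>n. Y (Suc (p (r n)))) \<longlonglongrightarrow> snd W"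
    using LIMSEQ_subseq_LIMSEQ[OF qX sub] LIMSEQ_subseq_LIMSEQ[OF qY sub] by (simp_all add: o_def Suc_p)
  have \<zeta>: "- z \<in> subdiff g (snd W)"
    by (rule subdiff_closed_graph[OF g yY tendsto_minus[OF z]])
      (rule MIALM_multiplier_subgradient[OF alg g \<rho>])
  have "\<exists>U F. open U \<and> fst W \<in> U \<and> smooth_on U F \<and> (\<forall>y\<in>M \<inter> U. F y = f y)"
    using assms(3) \<open>fst W \<in> M\<close> unfolding smooth_on_manifold_def by (rule bspec)
  then obtain U F where U: "open U" "fst W \<in> U" and F_smooth: "smooth_on U F"
    and F_eq: "\<forall>y\<in>M \<inter> U. F y = f y" by (elim exE conjE)
  note F = F_smooth F_eq[rule_format]
  define \<xi> where "\<xi> n = rgrad M (reduced_lagrangian f g A (\<rho> (p (r n))) (Zbar (p (r n)))) (X (Suc (p (r n))))" for n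
  have "(\<lambda>n. \<epsilon> (p (r n))) \<longlonglongrightarrow> 0"
    using LIMSEQ_subseq_LIMSEQ[OF assms(13) strict_mono_o[OF p r]] by (simp add: o_def)
  then have \<xi>: "\<xi> \<longlonglongrightarrow> 0"
    by (rule Lim_null_comparison[rotated]) (simp add: \<xi>_def assms(15))
  have stat: "\<xi> n \<bullet> v = frechet_derivative F (at (X (Suc (p (r n))))) v - Z (Suc (p (r n))) \<bullet> (A ** v)"
    if "X (Suc (p (r n))) \<in> U" "v \<in> tangent_space M (X (Suc (p (r n))))" for n v
    unfolding \<xi>_def by (rule MIALM_rgrad[OF alg g M \<rho> U(1) that(1) F that(2)])
  show "KKT_point M f g A W"
  proof (rule KKT_pointI[OF M _ feasible U F \<zeta>])
    show "W \<in> prod_manifold M" using \<open>fst W \<in> M\<close> by (simp add: prod_manifold_def mem_Times_iff)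
    show "frechet_derivative F (at (fst W)) v + - z \<bullet> (A ** v) = 0"
      if "v \<in> tangent_space M (fst W)" for v
    proof -
      have "frechet_derivative F (at (fst W)) v = z \<bullet> (A ** v)"
        by (rule stationarity_limit[OF M \<open>fst W \<in> M\<close> MIALM_D(1)[OF alg] U F(1)
              bounded_linear_matrix_mult xX z \<xi> _ that]) (rule stat)
      then show ?thesis by simp
    qed
  qed
qed

end
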